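(* Let $(M_1,F_1)$ and $(M_2,F_2)$ be Finsler manifolds, let $f$ be a product function, and let $(M,F)$, $M=M_1\times M_2$, $F=\sqrt{f(F_1^2,F_2^2)}$, be their Minkowskian product Finsler manifold with respect to $f$. Then $(M,F)$ is a weakly Landsberg manifold if and only if $(M_1,F_1)$ and $(M_2,F_2)$ are both weakly Landsberg manifolds.
   Context: A Finsler metric on a manifold $N$ is a function $F:TN\to[0,\infty)$ such that: $G=F^2$ is smooth on $TN\setminus\{0\}$; $F>0$ off the zero section; $F(x,\lambda y)=|\lambda|F(x,y)$ for all $\lambda\in\mathbb{R}$; and the Hessian $(G_{\alpha\beta})=\left(\frac{\partial^2G}{\partial y^\alpha\partial y^\beta}\right)$ (no factor $\frac12$) is positive definite off the zero section. $(G^{\alpha\beta})$ denotes the inverse matrix of $(G_{\alpha\beta})$. A product function is a continuous $f:[0,\infty)\times[0,\infty)\to[0,\infty)$ with: (a) $f(s,t)=0$ iff $(s,t)=(0,0)$; (b) $f(\lambda s,\lambda t)=\lambda f(s,t)$ for $\lambda\ge 0$; (c) $f$ is smooth on $(0,\infty)^2$; (d) $\frac{\partial f}{\partial s}\ne0$ and $\frac{\partial f}{\partial t}\neq0$ on $(0,\infty)^2$; (e) $\frac{\partial f}{\partial s}\frac{\partial f}{\partial t}-2f\frac{\partial^2f}{\partial s\partial t}\ne0$ on $(0,\infty)^2$. Given Finsler manifolds $(M_1,F_1)$, $(M_2,F_2)$ of dimensions $m$, $n$, put $K=F_1^2$, $H=F_2^2$. The Minkowskian product Finsler manifold with respect to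 $f$ is $M=M_1\times M_2$ with $F=\sqrt{f(K,H)}$ on $TM\cong TM_1\oplus TM_2$; write $G=F^2=f(K,H)$. Since $f$ is smooth only on the open quadrant, all geometric objects of $F$ are considered at points $(x,y)\in TM$ whose $TM_1$- and $TM_2$-components are both nonzero (i.e. $K\ne0$, $H\ne0$); $(G_{\alpha\beta})$ is invertible there. For a Finsler metric (or for the product $F$) with $G=F^2$, in induced local coordinates $(x^\alpha,y^\alpha)$ on the tangent bundle, set $\mathbb{G}^\alpha=\frac12G^{\alpha\beta}\left(\frac{\partial^2G}{\partial y^\beta\partial x^\gamma}y^\gamma-\frac{\partial G}{\partial x^\beta}\right)$ (summation convention). The Berwald curvature is $B^\alpha_{\beta\gamma\eta}=\frac{\partial^3\mathbb{G}^\alpha}{\partial y^\beta\partial y^\gamma\partial y^\eta}$, the Landsberg curvature is $L_{\beta\gamma\eta}=-\frac14y^\nu G_{\nu\alpha}B^\alpha_{\beta\gamma\eta}$, and the mean Landsberg curvature is $J_\alpha=2G^{\beta\gamma}L_{\alpha\beta\gamma}$. The manifold is weakly Landsberg if $J_\alpha\equiv0$. *)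

theory Defs
  imports "HOL-Analysis.Analysis"
begin

section \<open>Smooth maps\<close>

text \<open>
  Maps of class \<open>C\<^sup>k\<close> on an open set: all iterated directional derivatives up to order \<open>k\<close> exist
  and are continuous. Only meant for open \<open>S\<close>, since derivatives are taken with respect to the
  full neighbourhood filter, and for finite-dimensional domains.
\<close>

primrec Ck_on :: "nat \<Rightarrow> ('a::real_normed_vector \<Rightarrow> 'b::real_normed_vector) \<Rightarrow> 'a set \<Rightarrow> bool"
where
  "Ck_on 0 f S \<longleftrightarrow> continuous_on S f"
| "Ck_on (Suc k) f S \<longleftrightarrow>
     (\<forall>x\<in>S. f differentiable (at x)) \<and> (\<forall>v. Ck_on k (\<lambda>x. frechet_derivative f (at x) v) S)"

definition smooth_on :: "'a set \<Rightarrow> ('a::real_normed_vector \<Rightarrow> 'b::real_normed_vector) \<Rightarrow> bool"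
  where "smooth_on S f \<longleftrightarrow> (\<forall>k. Ck_on k f S)"


section \<open>Smooth manifolds and their tangent bundles\<close>

text \<open>A chart is a coordinate domain together with the coordinate map; the values of the map outside
  the domain are irrelevant.\<close>

type_synonym ('p, 'n) chart = "'p set \<times> ('p \<Rightarrow> real ^ 'n)"

definition chart_image :: "('p, 'n) chart \<Rightarrow> (real ^ 'n) set"
  where "chart_image c = snd c ` fst c"

definition chart_inv :: "('p, 'n) chart \<Rightarrow> real ^ 'n \<Rightarrow> 'p"
  where "chart_inv c = inv_into (fst c) (snd c)"

definition smooth_atlas :: "'p topology \<Rightarrow> ('p, 'n::finite) chart set \<Rightarrow> bool"
  where "smooth_atlas X A \<longleftrightarrow>
    (\<Union>c\<in>A. fst c) = topspace X \<and>
    (\<forall>c\<in>A. openin X (fst c) \<and> open (chart_image c) \<and>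
       homeomorphic_map (subtopology X (fst c)) (top_of_set (chart_image c)) (snd c)) \<and>
    (\<forall>c\<in>A. \<forall>d\<in>A. smooth_on (snd c ` (fst c \<inter> fst d)) (snd d \<circ> chart_inv c))"

definition smooth_manifold :: "'p topology \<Rightarrow> ('p, 'n::finite) chart set \<Rightarrow> bool"
  where "smooth_manifold X A \<longleftrightarrow>
    Hausdorff_space X \<and> second_countable X \<and> topspace X \<noteq> {} \<and> smooth_atlas X A"

text \<open>
  A tangent vector at \<open>p\<close> is a family of coordinate vectors, indexed by the charts of the atlas
  around \<open>p\<close>, that transforms by the Jacobians of the coordinate changes. For uniqueness of the
  representation the family is set to \<open>0\<close> at all other indices.
\<close>

type_synonym ('p, 'n) tvec = "'p \<times> (('p, 'n) chart \<Rightarrow> real ^ 'n)"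

definition tangent_bundle :: "('p, 'n::finite) chart set \<Rightarrow> ('p, 'n) tvec set"
  where "tangent_bundle A = {(p, \<xi>).
    p \<in> (\<Union>c\<in>A. fst c) \<and>
    (\<forall>c\<in>A. \<forall>d\<in>A. p \<in> fst c \<inter> fst d \<longrightarrow>
       \<xi> d = frechet_derivative (snd d \<circ> chart_inv c) (at (snd c p)) (\<xi> c)) \<and>
    (\<forall>c. \<not> (c \<in> A \<and> p \<in> fst c) \<longrightarrow> \<xi> c = 0)}"

type_synonym 'n coords = "(real ^ 'n) \<times> (real ^ 'n)"

definition is_zero :: "('p, 'n::finite) tvec \<Rightarrow> bool"
  where "is_zero v \<longleftrightarrow> snd v = (\<lambda>_. 0)"

definition tscale :: "real \<Rightarrow> ('p, 'n::finite) tvec \<Rightarrow> ('p, 'n) tvec"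
  where "tscale r v = (fst v, \<lambda>c. r *\<^sub>R snd v c)"

definition slit_tangent_bundle :: "('p, 'n::finite) chart set \<Rightarrow> ('p, 'n) tvec set"
  where "slit_tangent_bundle A = {v \<in> tangent_bundle A. \<not> is_zero v}"

text \<open>The induced coordinates \<open>(x, y)\<close> on the part of the tangent bundle over a chart domain, and
  the tangent vector with given induced coordinates.\<close>

definition tchart :: "('p, 'n) chart \<Rightarrow> ('p, 'n) tvec \<Rightarrow> 'n coords"
  where "tchart c v = (snd c (fst v), snd v c)"

definition tchart_inv ::
  "('p, 'n::finite) chart set \<Rightarrow> ('p, 'n) chart \<Rightarrow> 'n coords \<Rightarrow> ('p, 'n) tvec"
  where "tchart_inv A c = inv_into {v \<in> tangent_bundle A. fst v \<in> fst c} (tchart c)"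

definition local_rep ::
  "('p, 'n::finite) chart set \<Rightarrow> ('p, 'n) chart \<Rightarrow> (('p, 'n) tvec \<Rightarrow> real)
    \<Rightarrow> 'n coords \<Rightarrow> real"
  where "local_rep A c F = F \<circ> tchart_inv A c"

text \<open>The tangent map of a smooth map \<open>h\<close>. By the chain rule the coordinate vectors do not depend on
  the chart chosen at the source.\<close>

definition tangent_map ::
  "('p, 'm::finite) chart set \<Rightarrow> ('q, 'n::finite) chart set \<Rightarrow> ('p \<Rightarrow> 'q)
    \<Rightarrow> ('p, 'm) tvec \<Rightarrow> ('q, 'n) tvec"
  where "tangent_map A B h v =
    (let c = (SOME c. c \<in> A \<and> fst v \<in> fst c)
     in (h (fst v), \<lambda>d. if d \<in> B \<and> h (fst v) \<in> fst d
           then frechet_derivative (snd d \<circ> h \<circ> chart_inv c) (at (snd c (fst v))) (snd v c)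
           else 0))"

definition prod_chart :: "('p, 'm::finite) chart \<Rightarrow> ('q, 'n::finite) chart \<Rightarrow> ('p \<times> 'q, 'm + 'n) chart"
  where "prod_chart c d =
    (fst c \<times> fst d,
     \<lambda>(p, q). \<chi> i. case i of Inl a \<Rightarrow> snd c p $ a | Inr b \<Rightarrow> snd d q $ b)"

definition prod_atlas ::
  "('p, 'm::finite) chart set \<Rightarrow> ('q, 'n::finite) chart set \<Rightarrow> ('p \<times> 'q, 'm + 'n) chart set"
  where "prod_atlas A B = {prod_chart c d | c d. c \<in> A \<and> d \<in> B}"


section \<open>Curvature quantities in induced coordinates\<close>

text \<open>The functions below live on coordinate space, with points \<open>z = (x, y)\<close>; the argument \<open>G\<close> stands
  for the coordinate representation of the squared metric.\<close>

definition dx :: "'n \<Rightarrow> ('n coords \<Rightarrow> real) \<Rightarrow> 'n::finite coords \<Rightarrow> real"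
  where "dx \<alpha> g z = frechet_derivative g (at z) (axis \<alpha> 1, 0)"

definition dy :: "'n \<Rightarrow> ('n coords \<Rightarrow> real) \<Rightarrow> 'n::finite coords \<Rightarrow> real"
  where "dy \<alpha> g z = frechet_derivative g (at z) (0, axis \<alpha> 1)"

definition fundamental_matrix ::
  "('n coords \<Rightarrow> real) \<Rightarrow> 'n::finite coords \<Rightarrow> real ^ 'n ^ 'n"
  where "fundamental_matrix G z = (\<chi> \<alpha> \<beta>. dy \<alpha> (dy \<beta> G) z)"

definition inverse_fundamental_matrix ::
  "('n coords \<Rightarrow> real) \<Rightarrow> 'n::finite coords \<Rightarrow> real ^ 'n ^ 'n"
  where "inverse_fundamental_matrix G z = matrix_inv (fundamental_matrix G z)"

definition spray_coeff ::
  "('n coords \<Rightarrow> real) \<Rightarrow> 'n \<Rightarrow> 'n::finite coords \<Rightarrow> real"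
  where "spray_coeff G \<alpha> z =
    1/2 * (\<Sum>\<beta>\<in>UNIV. inverse_fundamental_matrix G z $ \<alpha> $ \<beta> *
             ((\<Sum>\<gamma>\<in>UNIV. dy \<beta> (dx \<gamma> G) z * snd z $ \<gamma>) - dx \<beta> G z))"

definition berwald_curvature ::
  "('n coords \<Rightarrow> real) \<Rightarrow> 'n \<Rightarrow> 'n \<Rightarrow> 'n \<Rightarrow> 'n \<Rightarrow> 'n::finite coords \<Rightarrow> real"
  where "berwald_curvature G \<alpha> \<beta> \<gamma> \<eta> = dy \<beta> (dy \<gamma> (dy \<eta> (spray_coeff G \<alpha>)))"

definition landsberg_curvature ::
  "('n coords \<Rightarrow> real) \<Rightarrow> 'n \<Rightarrow> 'n \<Rightarrow> 'n \<Rightarrow> 'n::finite coords \<Rightarrow> real"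
  where "landsberg_curvature G \<beta> \<gamma> \<eta> z =
    - (1/4) * (\<Sum>\<nu>\<in>UNIV. \<Sum>\<alpha>\<in>UNIV.
        snd z $ \<nu> * fundamental_matrix G z $ \<nu> $ \<alpha> * berwald_curvature G \<alpha> \<beta> \<gamma> \<eta> z)"

definition mean_landsberg_curvature ::
  "('n coords \<Rightarrow> real) \<Rightarrow> 'n \<Rightarrow> 'n::finite coords \<Rightarrow> real"
  where "mean_landsberg_curvature G \<alpha> z =
    2 * (\<Sum>\<beta>\<in>UNIV. \<Sum>\<gamma>\<in>UNIV.
        inverse_fundamental_matrix G z $ \<beta> $ \<gamma> * landsberg_curvature G \<alpha> \<beta> \<gamma> z)"


section \<open>Finsler manifolds\<close>

definition finsler_metric :: "('p, 'n::finite) chart set \<Rightarrow> (('p, 'n) tvec \<Rightarrow> real) \<Rightarrow> bool"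
  where "finsler_metric A F \<longleftrightarrow>
    (\<forall>v\<in>tangent_bundle A. 0 \<le> F v) \<and>
    (\<forall>c\<in>A. smooth_on (chart_image c \<times> (- {0})) (local_rep A c (\<lambda>v. (F v)\<^sup>2))) \<and>
    (\<forall>v\<in>slit_tangent_bundle A. 0 < F v) \<and>
    (\<forall>v\<in>tangent_bundle A. \<forall>r. F (tscale r v) = \<bar>r\<bar> * F v) \<and>
    (\<forall>c\<in>A. \<forall>x\<in>chart_image c. \<forall>y. y \<noteq> 0 \<longrightarrow>
       (\<forall>w. w \<noteq> 0 \<longrightarrow>
         0 < w \<bullet> (fundamental_matrix (local_rep A c (\<lambda>v. (F v)\<^sup>2)) (x, y) *v w)))"

definition finsler_manifold ::
  "'p topology \<Rightarrow> ('p, 'n::finite) chart set \<Rightarrow> (('p, 'n) tvec \<Rightarrow> real) \<Rightarrow> bool"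
  where "finsler_manifold X A F \<longleftrightarrow> smooth_manifold X A \<and> finsler_metric A F"

text \<open>Vanishing of the mean Landsberg curvature at all tangent vectors in \<open>D\<close>. The mean Landsberg
  curvature is tensorial, so testing it in the charts of one atlas suffices.\<close>

definition weakly_landsberg_on ::
  "('p, 'n::finite) tvec set \<Rightarrow> ('p, 'n) chart set \<Rightarrow> (('p, 'n) tvec \<Rightarrow> real) \<Rightarrow> bool"
  where "weakly_landsberg_on D A F \<longleftrightarrow>
    (\<forall>v\<in>D. \<forall>c\<in>A. fst v \<in> fst c \<longrightarrow>
       (\<forall>\<alpha>. mean_landsberg_curvature (local_rep A c (\<lambda>v. (F v)\<^sup>2)) \<alpha> (tchart c v) = 0))"

definition weakly_landsberg :: "('p, 'n::finite) chart set \<Rightarrow> (('p, 'n) tvec \<Rightarrow> real) \<Rightarrow> bool"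
  where "weakly_landsberg A F \<longleftrightarrow> weakly_landsberg_on (slit_tangent_bundle A) A F"


section \<open>Minkowskian products\<close>

definition d1 :: "(real \<times> real \<Rightarrow> real) \<Rightarrow> real \<times> real \<Rightarrow> real"
  where "d1 f z = frechet_derivative f (at z) (1, 0)"

definition d2 :: "(real \<times> real \<Rightarrow> real) \<Rightarrow> real \<times> real \<Rightarrow> real"
  where "d2 f z = frechet_derivative f (at z) (0, 1)"

text \<open>Only the values of \<open>f\<close> on the closed quadrant are relevant.\<close>

definition product_function :: "(real \<times> real \<Rightarrow> real) \<Rightarrow> bool"
  where "product_function f \<longleftrightarrow>
    continuous_on ({0..} \<times> {0..}) f \<and>
    (\<forall>s\<ge>0. \<forall>t\<ge>0. 0 \<le> f (s, t)) \<and>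
    (\<forall>s\<ge>0. \<forall>t\<ge>0. f (s, t) = 0 \<longleftrightarrow> (s, t) = (0, 0)) \<and>
    (\<forall>r\<ge>0. \<forall>s\<ge>0. \<forall>t\<ge>0. f (r * s, r * t) = r * f (s, t)) \<and>
    smooth_on ({0<..} \<times> {0<..}) f \<and>
    (\<forall>s>0. \<forall>t>0. d1 f (s, t) \<noteq> 0 \<and> d2 f (s, t) \<noteq> 0) \<and>
    (\<forall>s>0. \<forall>t>0. d1 f (s, t) * d2 f (s, t) - 2 * f (s, t) * d1 (d2 f) (s, t) \<noteq> 0)"

text \<open>The two components of a tangent vector of a product under \<open>TM = TM\<^sub>1 \<oplus> TM\<^sub>2\<close>.\<close>

definition tangent_fst ::
  "('p, 'm::finite) chart set \<Rightarrow> ('q, 'n::finite) chart set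
    \<Rightarrow> ('p \<times> 'q, 'm + 'n) tvec \<Rightarrow> ('p, 'm) tvec"
  where "tangent_fst A B = tangent_map (prod_atlas A B) A fst"

definition tangent_snd ::
  "('p, 'm::finite) chart set \<Rightarrow> ('q, 'n::finite) chart set
    \<Rightarrow> ('p \<times> 'q, 'm + 'n) tvec \<Rightarrow> ('q, 'n) tvec"
  where "tangent_snd A B = tangent_map (prod_atlas A B) B snd"

definition minkowskian_product ::
  "(real \<times> real \<Rightarrow> real) \<Rightarrow> ('p, 'm::finite) chart set \<Rightarrow> (('p, 'm) tvec \<Rightarrow> real)
    \<Rightarrow> ('q, 'n::finite) chart set \<Rightarrow> (('q, 'n) tvec \<Rightarrow> real)
    \<Rightarrow> ('p \<times> 'q, 'm + 'n) tvec \<Rightarrow> real"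
  where "minkowskian_product f A F B F' v =
    sqrt (f ((F (tangent_fst A B v))\<^sup>2, (F' (tangent_snd A B v))\<^sup>2))"

text \<open>The product function is smooth only on the open quadrant, so the geometry of the product is
  considered only at tangent vectors both of whose components are nonzero.\<close>

definition product_slit_bundle ::
  "('p, 'm::finite) chart set \<Rightarrow> ('q, 'n::finite) chart set \<Rightarrow> ('p \<times> 'q, 'm + 'n) tvec set"
  where "product_slit_bundle A B =
    {v \<in> tangent_bundle (prod_atlas A B).
       \<not> is_zero (tangent_fst A B v) \<and> \<not> is_zero (tangent_snd A B v)}"

definition weakly_landsberg_product ::
  "(real \<times> real \<Rightarrow> real) \<Rightarrow> ('p, 'm::finite) chart set \<Rightarrow> (('p, 'm) tvec \<Rightarrow> real)
    \<Rightarrow> ('q, 'n::finite) chart set \<Rightarrow> (('q, 'n) tvec \<Rightarrow> real) \<Rightarrow> bool"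
  where "weakly_landsberg_product f A F B F' \<longleftrightarrow>
    weakly_landsberg_on (product_slit_bundle A B) (prod_atlas A B)
      (minkowskian_product f A F B F')"

end

theory Submission
  imports Defs
begin

text \<open>
  Write \<open>K\<close>, \<open>H\<close> for the squared metrics of the two factors and \<open>G = f (K, H)\<close> for that of the product.
  The theorem is local, and it holds because the mean Landsberg curvature of the product is, component
  by component, that of the factors: at a vector with components \<open>x\<close> and \<open>w\<close>, its value in a
  direction of the first factor is the mean Landsberg curvature of \<open>K\<close> at \<open>x\<close>, with no factor coming
  from \<open>f\<close>, and likewise for the second factor (\<open>mean_landsberg_product\<close>).

  Everything follows from homogeneity. The metrics are homogeneous of degree 2 in the fibre variable
  \<open>y\<close>, so Euler's relations (\<open>euler_y_homogeneous\<close>, \<open>euler_dy_y_homogeneous\<close>) say that the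
  fundamental matrix \<open>g\<close> of \<open>K\<close> and the fibre differential \<open>dK\<close> are related by \<open>g y = dK\<close> and
  \<open>y \<bullet> dK = 2 K\<close>. The function \<open>f\<close> is homogeneous of degree 1, so its second partial derivatives
  satisfy \<open>s f\<^sub>s\<^sub>s + t f\<^sub>s\<^sub>t = 0\<close> and \<open>s f\<^sub>s\<^sub>t + t f\<^sub>t\<^sub>t = 0\<close>. There are three consequences.

  First, the fundamental matrix of \<open>G\<close> is a multiple of \<open>g\<close> on the first diagonal block, a multiple of
  its analogue on the second, plus rank one terms built from \<open>dK\<close> and \<open>dH\<close>. Its inverse has the same
  shape, with the inverse matrices on the diagonal and rank one terms built from the fibre variables, whose
  coefficients are found by dividing by \<open>f\<^sub>s f\<^sub>t - 2 f f\<^sub>s\<^sub>t\<close>, which is nonzero for a product function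
  (\<open>inverse_fundamental_matrix_product\<close>).

  Second, the spray coefficients of the factors, taken together, solve the linear system that
  defines the spray coefficients of \<open>G\<close> (\<open>spray_coeff_product\<close>). So the Berwald curvature of the
  product consists of the two Berwald curvatures, with all mixed components zero. Contracting with
  the fibre variable through the fundamental matrix multiplies the first one by \<open>f\<^sub>s\<close> and the second one
  by \<open>f\<^sub>t\<close> (\<open>landsberg_product\<close>).

  Third, the mean Landsberg curvature contracts this with the inverse matrix. The factor \<open>f\<^sub>s\<close> cancels
  against the \<open>1 / f\<^sub>s\<close> of the inverse, and the rank one terms vanish because the Landsberg curvature is
  annihilated by the fibre variable (\<open>y_landsberg\<close>, \<open>trace_landsberg\<close>); this last fact is Euler's
  relation for the spray coefficients.

  To pass from charts to manifolds it suffices that tangent vectors over a chart domain correspond to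
  coordinate pairs (\<open>tchart_inv_tchart\<close>, \<open>tchart_surj\<close>) and that in product charts the two components
  of a tangent vector of the product are given by projecting the coordinates
  (\<open>tangent_fst_product\<close>). A vector of one factor can always be completed to a vector of the product
  with nonzero components, since the other factor is nonempty; so vanishing for the product
  forces vanishing for both factors.
\<close>

section \<open>Calculus of smooth functions\<close>

text \<open>
  The two functions have the same derivatives at \<open>x\<close>, so the choice operator behind
  \<^const>\<open>frechet_derivative\<close> selects the same map for both, even where there is no derivative.
\<close>

lemma frechet_derivative_cong_open:
  assumes "open S" "x \<in> S" "\<And>z. z \<in> S \<Longrightarrow> f z = g z"
  shows "frechet_derivative f (at x) = frechet_derivative g (at x)"
proof -
  have "(f has_derivative D) (at x) \<longleftrightarrow> (g has_derivative D) (at x)" for D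
    using has_derivative_transform_within_open[OF _ assms(1,2)] assms(3) by metis
  then show ?thesis by (simp add: frechet_derivative_def)
qed

lemma differentiable_cong_open:
  assumes "open S" "x \<in> S" "\<And>z. z \<in> S \<Longrightarrow> f z = g z" "f differentiable (at x)"
  shows "g differentiable (at x)"
  using assms has_derivative_transform_within_open unfolding differentiable_def by metis

lemma frechet_derivative_mult:
  fixes f g :: "'a::real_normed_vector \<Rightarrow> real"
  assumes "f differentiable (at x)" "g differentiable (at x)"
  shows "frechet_derivative (\<lambda>z. f z * g z) (at x) v =
    f x * frechet_derivative g (at x) v + frechet_derivative f (at x) v * g x"
proof -
  have "((\<lambda>z. f z * g z) has_derivative
      (\<lambda>v. f x * frechet_derivative g (at x) v + frechet_derivative f (at x) v * g x)) (at x)"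
    using assms by (intro has_derivative_mult) (auto simp: frechet_derivative_works[symmetric])
  then show ?thesis by (metis frechet_derivative_at)
qed

lemma frechet_derivative_plus:
  assumes "f differentiable (at x)" "g differentiable (at x)"
  shows "frechet_derivative (\<lambda>z. f z + g z) (at x) v =
    frechet_derivative f (at x) v + frechet_derivative g (at x) v"
proof -
  have "((\<lambda>z. f z + g z) has_derivative
      (\<lambda>v. frechet_derivative f (at x) v + frechet_derivative g (at x) v)) (at x)"
    using assms by (intro has_derivative_add) (auto simp: frechet_derivative_works[symmetric])
  then show ?thesis by (metis frechet_derivative_at)
qed

lemma frechet_derivative_sum:
  fixes f :: "'i \<Rightarrow> 'a::real_normed_vector \<Rightarrow> 'b::real_normed_vector"
  assumes "\<And>i. i \<in> I \<Longrightarrow> f i differentiable (at x)"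
  shows "frechet_derivative (\<lambda>z. \<Sum>i\<in>I. f i z) (at x) v =
    (\<Sum>i\<in>I. frechet_derivative (f i) (at x) v)"
proof -
  have "((\<lambda>z. \<Sum>i\<in>I. f i z) has_derivative
      (\<lambda>v. \<Sum>i\<in>I. frechet_derivative (f i) (at x) v)) (at x)"
    using assms by (intro has_derivative_sum) (auto simp: frechet_derivative_works[symmetric])
  then show ?thesis by (metis frechet_derivative_at)
qed

lemma frechet_derivative_bounded_linear:
  assumes "bounded_linear f"
  shows "frechet_derivative f (at x) = f"
  using bounded_linear.has_derivative[OF assms has_derivative_ident]
  by (metis frechet_derivative_at)

lemma frechet_derivative_compose_linear:
  assumes "bounded_linear L" "g differentiable (at (L x))"
  shows "frechet_derivative (\<lambda>z. g (L z)) (at x) v = frechet_derivative g (at (L x)) (L v)"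
proof -
  have "(L has_derivative L) (at x)"
    using bounded_linear.has_derivative[OF assms(1) has_derivative_ident] .
  moreover have "(g has_derivative frechet_derivative g (at (L x))) (at (L x))"
    using assms(2) by (simp add: frechet_derivative_works)
  ultimately have "(g \<circ> L has_derivative frechet_derivative g (at (L x)) \<circ> L) (at x)"
    by (rule diff_chain_at)
  then show ?thesis by (simp add: frechet_derivative_at[symmetric] comp_def)
qed

lemma frechet_derivative_linear_compose:
  assumes "bounded_linear L" "g differentiable (at x)"
  shows "frechet_derivative (\<lambda>z. L (g z)) (at x) v = L (frechet_derivative g (at x) v)"
proof -
  have "(g has_derivative frechet_derivative g (at x)) (at x)"
    using assms(2) by (simp add: frechet_derivative_works)
  from bounded_linear.has_derivative[OF assms(1) this]
  have "frechet_derivative (\<lambda>z. L (g z)) (at x) = (\<lambda>v. L (frechet_derivative g (at x) v))"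
    by (rule frechet_derivative_at[symmetric])
  then show ?thesis by simp
qed

lemma Ck_on_cong:
  assumes "open S"
  shows "(\<And>x. x \<in> S \<Longrightarrow> f x = g x) \<Longrightarrow> Ck_on k f S \<Longrightarrow> Ck_on k g S"
proof (induction k arbitrary: f g)
  case 0
  then show ?case using continuous_on_cong[of S S f g] by simp
next
  case (Suc k)
  have "Ck_on k (\<lambda>x. frechet_derivative g (at x) v) S" for v
    by (rule Suc.IH[of "\<lambda>x. frechet_derivative f (at x) v"])
      (use Suc.prems frechet_derivative_cong_open[OF assms, of _ f g] in auto)
  moreover have "\<forall>x\<in>S. g differentiable (at x)"
    using differentiable_cong_open[OF assms, of _ f g] Suc.prems by simp
  ultimately show ?case by simp
qed

lemma Ck_on_SucD: "Ck_on (Suc k) f S \<Longrightarrow> Ck_on k f S"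
proof (induction k arbitrary: f)
  case 0
  then show ?case
    by (auto intro!: continuous_at_imp_continuous_on differentiable_imp_continuous_within)
next
  case (Suc k)
  then show ?case by auto
qed

lemma Ck_on_const: "Ck_on k (\<lambda>x. c) S"
  by (induction k arbitrary: c) auto

lemma Ck_on_add:
  assumes "open S"
  shows "Ck_on k f S \<Longrightarrow> Ck_on k g S \<Longrightarrow> Ck_on k (\<lambda>x. f x + g x) S"
proof (induction k arbitrary: f g)
  case 0
  then show ?case by (simp add: continuous_on_add)
next
  case (Suc k)
  have "Ck_on k (\<lambda>x. frechet_derivative (\<lambda>x. f x + g x) (at x) v) S" for v
    by (rule Ck_on_cong[OF assms, of
          "\<lambda>x. frechet_derivative f (at x) v + frechet_derivative g (at x) v"])
      (use Suc in \<open>auto simp: frechet_derivative_plus\<close>)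
  then show ?case using Suc.prems by auto
qed

lemma Ck_on_mult:
  fixes f g :: "'a::real_normed_vector \<Rightarrow> real"
  assumes "open S"
  shows "Ck_on k f S \<Longrightarrow> Ck_on k g S \<Longrightarrow> Ck_on k (\<lambda>x. f x * g x) S"
proof (induction k arbitrary: f g)
  case 0
  then show ?case by (simp add: continuous_on_mult)
next
  case (Suc k)
  have *: "Ck_on k f S" "Ck_on k g S" using Suc.prems Ck_on_SucD by blast+
  have "Ck_on k (\<lambda>x. frechet_derivative (\<lambda>x. f x * g x) (at x) v) S" for v
    by (rule Ck_on_cong[OF assms, of
          "\<lambda>x. f x * frechet_derivative g (at x) v + frechet_derivative f (at x) v * g x"])
      (use Suc * in \<open>auto simp: frechet_derivative_mult intro!: Ck_on_add[OF assms]\<close>)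
  then show ?case using Suc.prems by auto
qed

lemma Ck_on_inverse:
  fixes f :: "'a::real_normed_vector \<Rightarrow> real"
  assumes "open S" "\<And>x. x \<in> S \<Longrightarrow> f x \<noteq> 0"
  shows "Ck_on k f S \<Longrightarrow> Ck_on k (\<lambda>x. inverse (f x)) S"
proof (induction k)
  case 0
  then show ?case using assms by (simp add: continuous_on_inverse)
next
  case (Suc k)
  have *: "Ck_on k (\<lambda>x. inverse (f x)) S" using Suc Ck_on_SucD by blast
  have D: "((\<lambda>x. inverse (f x)) has_derivative
      (\<lambda>v. - (inverse (f x) * frechet_derivative f (at x) v * inverse (f x)))) (at x)"
    if "x \<in> S" for x
    using Suc.prems assms(2) that
    by (intro Deriv.has_derivative_inverse) (auto simp: frechet_derivative_works[symmetric])
  have "Ck_on k (\<lambda>x. frechet_derivative (\<lambda>x. inverse (f x)) (at x) v) S" for v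
  proof (rule Ck_on_cong[OF assms(1)])
    show "Ck_on k (\<lambda>x. (- 1) * (inverse (f x) * frechet_derivative f (at x) v * inverse (f x))) S"
      using Suc.prems * by (intro Ck_on_mult[OF assms(1)] Ck_on_const) auto
  qed (simp add: frechet_derivative_at[OF D, symmetric])
  then show ?case using D by (auto simp: differentiable_def)
qed

lemma smooth_onD:
  assumes "smooth_on S f"
  shows "x \<in> S \<Longrightarrow> f differentiable (at x)"
    and "smooth_on S (\<lambda>x. frechet_derivative f (at x) v)"
  using assms unfolding smooth_on_def by (metis Ck_on.simps(2))+

lemma smooth_on_cong:
  "open S \<Longrightarrow> smooth_on S f \<Longrightarrow> (\<And>x. x \<in> S \<Longrightarrow> f x = g x) \<Longrightarrow> smooth_on S g"
  unfolding smooth_on_def using Ck_on_cong by metis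

lemma smooth_on_const: "smooth_on S (\<lambda>x. c)"
  by (simp add: smooth_on_def Ck_on_const)

lemma smooth_on_add: "open S \<Longrightarrow> smooth_on S f \<Longrightarrow> smooth_on S g \<Longrightarrow> smooth_on S (\<lambda>x. f x + g x)"
  by (simp add: smooth_on_def Ck_on_add)

lemma smooth_on_mult:
  fixes f g :: "'a::real_normed_vector \<Rightarrow> real"
  shows "open S \<Longrightarrow> smooth_on S f \<Longrightarrow> smooth_on S g \<Longrightarrow> smooth_on S (\<lambda>x. f x * g x)"
  by (simp add: smooth_on_def Ck_on_mult)

lemma smooth_on_diff:
  fixes f g :: "'a::real_normed_vector \<Rightarrow> real"
  assumes "open S" "smooth_on S f" "smooth_on S g"
  shows "smooth_on S (\<lambda>x. f x - g x)"
  using smooth_on_add[OF assms(1,2) smooth_on_mult[OF assms(1) smooth_on_const[of S "-1"] assms(3)]]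
  by simp

lemma smooth_on_divide:
  fixes f g :: "'a::real_normed_vector \<Rightarrow> real"
  assumes "open S" "smooth_on S f" "smooth_on S g" "\<And>x. x \<in> S \<Longrightarrow> g x \<noteq> 0"
  shows "smooth_on S (\<lambda>x. f x / g x)"
  unfolding divide_inverse
  using assms by (intro smooth_on_mult) (auto simp: smooth_on_def Ck_on_inverse)

lemma smooth_on_sum:
  "open S \<Longrightarrow> (\<And>i. i \<in> I \<Longrightarrow> smooth_on S (f i)) \<Longrightarrow> smooth_on S (\<lambda>x. \<Sum>i\<in>I. f i x)"
  by (induction I rule: infinite_finite_induct) (auto intro: smooth_on_const smooth_on_add)

lemma smooth_on_prod:
  fixes f :: "'i \<Rightarrow> 'a::real_normed_vector \<Rightarrow> real"
  shows "open S \<Longrightarrow> (\<And>i. i \<in> I \<Longrightarrow> smooth_on S (f i)) \<Longrightarrow> smooth_on S (\<lambda>x. \<Prod>i\<in>I. f i x)"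
  by (induction I rule: infinite_finite_induct) (auto intro: smooth_on_const smooth_on_mult)

lemma smooth_on_bounded_linear:
  assumes "bounded_linear f"
  shows "smooth_on S f"
proof -
  have "Ck_on k f S" for k
  proof (cases k)
    case 0
    then show ?thesis using assms by (simp add: linear_continuous_on)
  next
    case (Suc j)
    then show ?thesis
      using assms by (auto simp: frechet_derivative_bounded_linear bounded_linear_imp_differentiable Ck_on_const)
  qed
  then show ?thesis by (simp add: smooth_on_def)
qed

lemma smooth_on_det:
  fixes A :: "'a::real_normed_vector \<Rightarrow> real ^ 'n ^ 'n"
  assumes "open S" "\<And>i j. smooth_on S (\<lambda>x. A x $ i $ j)"
  shows "smooth_on S (\<lambda>x. det (A x))"
  unfolding det_def using assms
  by (intro smooth_on_sum smooth_on_mult smooth_on_prod smooth_on_const)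

lemma
  fixes A :: "real ^ 'n ^ 'n"
  assumes "invertible A"
  shows matrix_inv_right: "A ** matrix_inv A = mat 1"
    and matrix_inv_left: "matrix_inv A ** A = mat 1"
  using someI_ex[OF assms[unfolded invertible_def]] by (simp_all add: matrix_inv_def)

lemma
  fixes A B :: "real ^ 'n ^ 'n"
  assumes "A ** B = mat 1"
  shows right_inverse_invertible: "invertible A"
    and matrix_inv_eq_right_inverse: "matrix_inv A = B"
proof -
  show *: "invertible A" using assms by (auto simp: invertible_right_inverse)
  show "matrix_inv A = B"
    by (metis assms matrix_inv_left[OF *] matrix_mul_assoc matrix_mul_lid matrix_mul_rid)
qed

text \<open>Cramer's rule writes the entries of the inverse as quotients of determinants.\<close>

lemma smooth_on_matrix_inv:
  fixes A :: "'a::real_normed_vector \<Rightarrow> real ^ 'n ^ 'n"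
  assumes S: "open S" and A: "\<And>i j. smooth_on S (\<lambda>x. A x $ i $ j)"
    and inv: "\<And>x. x \<in> S \<Longrightarrow> invertible (A x)"
  shows "smooth_on S (\<lambda>x. matrix_inv (A x) $ i $ j)"
proof -
  let ?B = "\<lambda>x. \<chi> k l. if l = i then axis j 1 $ k else A x $ k $ l"
  have eq: "matrix_inv (A x) $ i $ j = det (?B x) / det (A x)" if "x \<in> S" for x
  proof -
    have "A x *v (matrix_inv (A x) *v axis j 1) = axis j 1"
      using inv[OF that] by (simp add: matrix_vector_mul_assoc matrix_inv_right)
    then have "(matrix_inv (A x) *v axis j 1) $ i = det (?B x) / det (A x)"
      using cramer[of "A x" "matrix_inv (A x) *v axis j 1" "axis j 1"] inv[OF that]
      by (simp add: invertible_det_nz)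
    then show ?thesis by (simp add: matrix_vector_mul_component inner_axis)
  qed
  have "smooth_on S (\<lambda>x. ?B x $ k $ l)" for k l
    using A by (cases "l = i") (auto intro: smooth_on_const)
  then have "smooth_on S (\<lambda>x. det (?B x) / det (A x))"
    using S A inv by (intro smooth_on_divide smooth_on_det) (auto simp: invertible_det_nz)
  then show ?thesis by (rule smooth_on_cong[OF S]) (simp add: eq)
qed

section \<open>Functions homogeneous in the fibre variable\<close>

lemma frechet_derivative_y_expansion:
  fixes g :: "'n::finite coords \<Rightarrow> real"
  assumes "g differentiable (at z)"
  shows "frechet_derivative g (at z) (0, w) = (\<Sum>b\<in>UNIV. w $ b * dy b g z)"
proof -
  have lin: "linear (frechet_derivative g (at z))"
    using assms by (rule linear_frechet_derivative)
  have "(0, w) = (\<Sum>b\<in>UNIV. w $ b *\<^sub>R (0 :: real ^ 'n, axis b 1 :: real ^ 'n))"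
    using basis_expansion[of w]
    by (simp add: prod_eq_iff fst_sum snd_sum scalar_mult_eq_scaleR)
  then have "frechet_derivative g (at z) (0, w) = frechet_derivative g (at z)
      (\<Sum>b\<in>UNIV. w $ b *\<^sub>R (0 :: real ^ 'n, axis b 1 :: real ^ 'n))"
    by (rule arg_cong)
  also have "\<dots> = (\<Sum>b\<in>UNIV. w $ b * dy b g z)"
    unfolding linear_sum[OF lin] linear_cmul[OF lin] dy_def by simp
  finally show ?thesis .
qed

text \<open>
  Homogeneity in the positive sense, on the complement of the zero section, where all the functions
  concerned are smooth.
\<close>

definition y_homogeneous :: "nat \<Rightarrow> (real ^ 'n) set \<Rightarrow> ('n::finite coords \<Rightarrow> real) \<Rightarrow> bool"
  where "y_homogeneous k V g \<longleftrightarrow>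
    (\<forall>x\<in>V. \<forall>y. y \<noteq> 0 \<longrightarrow> (\<forall>r>0. g (x, r *\<^sub>R y) = r ^ k * g (x, y)))"

lemma y_homogeneousD:
  "y_homogeneous k V g \<Longrightarrow> x \<in> V \<Longrightarrow> y \<noteq> 0 \<Longrightarrow> 0 < r \<Longrightarrow> g (x, r *\<^sub>R y) = r ^ k * g (x, y)"
  by (simp add: y_homogeneous_def)

lemma open_punctured_fibres: "open V \<Longrightarrow> open (V \<times> (- {0 :: real ^ 'n}))"
  by (intro open_Times) auto

text \<open>
  Differentiating \<open>g (x, r y) = r ^ k g (x, y)\<close> in the direction \<open>(a, b)\<close>: the fibre part of the
  direction is scaled by \<open>r\<close> as well. Hence \<open>x\<close>-derivatives keep the degree of homogeneity and
  \<open>y\<close>-derivatives lower it by one.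
\<close>

lemma frechet_derivative_y_homogeneous:
  fixes g :: "'n::finite coords \<Rightarrow> real"
  assumes V: "open V" and g: "y_homogeneous k V g"
    and diff: "\<And>z. z \<in> V \<times> (- {0}) \<Longrightarrow> g differentiable (at z)"
    and xy: "x \<in> V" "y \<noteq> 0" and r: "0 < r"
  shows "frechet_derivative g (at (x, r *\<^sub>R y)) (a, r *\<^sub>R b) =
    r ^ k * frechet_derivative g (at (x, y)) (a, b)"
proof -
  let ?L = "\<lambda>z :: 'n coords. (fst z, r *\<^sub>R snd z)"
  have L: "bounded_linear ?L"
    using bounded_linear_compose[OF bounded_linear_scaleR_right bounded_linear_snd, of r]
    by (intro bounded_linear_Pair bounded_linear_fst)
  have gL: "g (?L z) = r ^ k * g z" if "z \<in> V \<times> (- {0})" for z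
    using that y_homogeneousD[OF g _ _ r] by (cases z) auto
  have "frechet_derivative g (at (?L (x, y))) (?L (a, b)) =
      frechet_derivative (\<lambda>z. g (?L z)) (at (x, y)) (a, b)"
    using diff xy r by (intro frechet_derivative_compose_linear[OF L, symmetric]) auto
  also have "\<dots> = frechet_derivative (\<lambda>z. r ^ k * g z) (at (x, y)) (a, b)"
    using frechet_derivative_cong_open[OF open_punctured_fibres[OF V], of "(x, y)" "\<lambda>z. g (?L z)"] gL xy
    by simp
  also have "\<dots> = r ^ k * frechet_derivative g (at (x, y)) (a, b)"
    using diff xy by (subst frechet_derivative_mult) auto
  finally show ?thesis by simp
qed

lemma y_homogeneous_dx:
  assumes "open V" "y_homogeneous k V g" "\<And>z. z \<in> V \<times> (- {0}) \<Longrightarrow> g differentiable (at z)"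
  shows "y_homogeneous k V (dx a (g :: 'n::finite coords \<Rightarrow> real))"
  unfolding y_homogeneous_def
proof (intro ballI allI impI)
  fix x y :: "real ^ 'n" and r :: real assume "x \<in> V" "y \<noteq> 0" "r > 0"
  from frechet_derivative_y_homogeneous[OF assms this(1,2,3), of "axis a 1" 0]
  show "dx a g (x, r *\<^sub>R y) = r ^ k * dx a g (x, y)"
    by (simp add: dx_def)
qed

lemma y_homogeneous_dy:
  assumes "open V" "y_homogeneous (Suc k) V g"
    "\<And>z. z \<in> V \<times> (- {0}) \<Longrightarrow> g differentiable (at z)"
  shows "y_homogeneous k V (dy a (g :: 'n::finite coords \<Rightarrow> real))"
  unfolding y_homogeneous_def
proof (intro ballI allI impI)
  fix x y :: "real ^ 'n" and r :: real assume *: "x \<in> V" "y \<noteq> 0" "r > 0"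
  let ?D = "frechet_derivative g (at (x, r *\<^sub>R y))"
  have "linear ?D" using assms(3) * by (intro linear_frechet_derivative) auto
  from linear_cmul[OF this, of r "(0, axis a 1)"]
  have "?D (0, r *\<^sub>R axis a 1) = r * ?D (0, axis a 1)" by simp
  with frechet_derivative_y_homogeneous[OF assms *, of 0 "axis a 1"] *(3)
  show "dy a g (x, r *\<^sub>R y) = r ^ k * dy a g (x, y)"
    by (simp add: dy_def)
qed

text \<open>
  Both sides are the derivative of \<open>g (x, r y) = r ^ k g (x, y)\<close> with respect to \<open>r\<close> at \<open>r = 1\<close>.
\<close>

theorem euler_y_homogeneous:
  assumes g: "y_homogeneous k V g" and x: "x \<in> V" and y: "y \<noteq> 0"
    and diff: "g differentiable (at (x, y))"
  shows "(\<Sum>b\<in>UNIV. y $ b * dy b g (x, y)) = real k * g (x, y)"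
proof -
  let ?c = "\<lambda>r::real. (x, r *\<^sub>R y)"
  have c: "(?c has_derivative (\<lambda>h. (0, h *\<^sub>R y))) (at 1)"
    by (intro has_derivative_Pair has_derivative_const has_derivative_scaleR_left has_derivative_ident)
  have "(g has_derivative frechet_derivative g (at (x, y))) (at (?c 1))"
    using diff by (simp add: frechet_derivative_works)
  from diff_chain_at[OF c this]
  have 1: "((\<lambda>r. g (?c r)) has_derivative (\<lambda>h. frechet_derivative g (at (x, y)) (0, h *\<^sub>R y))) (at 1)"
    by (simp add: comp_def)
  have "((\<lambda>r. r ^ k * g (x, y)) has_derivative (\<lambda>h. h * (real k * g (x, y)))) (at 1)"
    using has_derivative_mult_left[OF has_derivative_power[OF has_derivative_ident], of k "g (x, y)" 1 UNIV]
    by (simp add: mult_ac)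
  then have "((\<lambda>r. g (?c r)) has_derivative (\<lambda>h. h * (real k * g (x, y)))) (at 1)"
    by (rule has_derivative_transform_within_open[where s = "{0<..}"])
      (simp_all add: y_homogeneousD[OF g x y])
  from fun_cong[OF has_derivative_unique[OF 1 this], of 1]
  have "frechet_derivative g (at (x, y)) (0, y) = real k * g (x, y)"
    by simp
  then show ?thesis by (simp add: frechet_derivative_y_expansion[OF diff])
qed

lemma smooth_on_dy: "smooth_on S g \<Longrightarrow> smooth_on S (dy a g)"
  unfolding dy_def[abs_def] by (rule smooth_onD(2))

lemma smooth_on_dx: "smooth_on S g \<Longrightarrow> smooth_on S (dx a g)"
  unfolding dx_def[abs_def] by (rule smooth_onD(2))

lemma bounded_linear_snd_nth: "bounded_linear (\<lambda>z :: 'n::finite coords. snd z $ b)"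
  by (rule bounded_linear_compose[OF bounded_linear_vec_nth bounded_linear_snd])

lemma smooth_on_snd_nth: "smooth_on S (\<lambda>z :: 'n::finite coords. snd z $ b)"
  by (rule smooth_on_bounded_linear[OF bounded_linear_snd_nth])

lemma dy_cong:
  "open S \<Longrightarrow> z \<in> S \<Longrightarrow> (\<And>z. z \<in> S \<Longrightarrow> g z = h z) \<Longrightarrow> dy a g z = dy a h z"
  unfolding dy_def by (rule fun_cong[OF frechet_derivative_cong_open])

text \<open>
  This is the \<open>y\<close>-derivative of Euler's relation. It contracts over the inner index of the Hessian,
  whereas Euler's relation for \<open>dy a g\<close> contracts over the outer one.
\<close>

lemma euler_dy_y_homogeneous:
  fixes g :: "'n::finite coords \<Rightarrow> real"
  assumes V: "open V" and g: "y_homogeneous k V g" and smooth: "smooth_on (V \<times> (- {0})) g"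
    and x: "x \<in> V" and y: "y \<noteq> 0"
  shows "(\<Sum>b\<in>UNIV. y $ b * dy a (dy b g) (x, y)) = (real k - 1) * dy a g (x, y)"
proof -
  let ?S = "V \<times> (- {0}) :: 'n coords set"
  have S: "open ?S" "(x, y) \<in> ?S" using open_punctured_fibres[OF V] x y by auto
  have diff: "g differentiable (at z)" "dy b g differentiable (at z)" if "z \<in> ?S" for b z
    using smooth_onD(1)[OF smooth that] smooth_onD(1)[OF smooth_on_dy[OF smooth] that] .
  have snd: "(\<lambda>z :: 'n coords. snd z $ b) differentiable (at z)" for b z
    by (rule bounded_linear_imp_differentiable[OF bounded_linear_snd_nth])
  have "real k * dy a g (x, y) = dy a (\<lambda>z. real k * g z) (x, y)"
    using diff S unfolding dy_def by (subst frechet_derivative_mult) auto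
  also have "\<dots> = dy a (\<lambda>z. \<Sum>b\<in>UNIV. snd z $ b * dy b g z) (x, y)"
  proof (rule dy_cong[OF S])
    fix w assume "w \<in> ?S"
    then show "real k * g w = (\<Sum>b\<in>UNIV. snd w $ b * dy b g w)"
      using euler_y_homogeneous[OF g _ _ diff(1), of "fst w" "snd w"] by (cases w) simp
  qed
  also have "\<dots> = (\<Sum>b\<in>UNIV. y $ b * dy a (dy b g) (x, y) +
      axis a 1 $ b * dy b g (x, y))"
    unfolding dy_def[of a]
    using diff(2)[OF S(2)] snd
    by (subst frechet_derivative_sum)
      (auto simp: frechet_derivative_mult frechet_derivative_bounded_linear[OF bounded_linear_snd_nth])
  also have "\<dots> = (\<Sum>b\<in>UNIV. y $ b * dy a (dy b g) (x, y)) + dy a g (x, y)"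
    by (simp add: sum.distrib axis_def if_distrib[of "\<lambda>t. t * _"] cong: if_cong)
  finally show ?thesis by (simp add: algebra_simps)
qed

section \<open>Finsler metrics in a chart\<close>

text \<open>
  A squared Finsler metric \<open>K\<close> in induced coordinates over an open set \<open>V\<close>. Positive definiteness of the
  Hessian enters through the invertibility of the fundamental matrix.
\<close>

locale finsler_chart =
  fixes V :: "(real ^ 'n::finite) set" and K :: "'n coords \<Rightarrow> real"
  assumes open_base: "open V"
    and smooth: "smooth_on (V \<times> (- {0})) K"
    and homogeneous: "y_homogeneous 2 V K"
    and positive: "x \<in> V \<Longrightarrow> y \<noteq> 0 \<Longrightarrow> 0 < K (x, y)"
    and nondegenerate: "x \<in> V \<Longrightarrow> y \<noteq> 0 \<Longrightarrow> invertible (fundamental_matrix K (x, y))"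
begin

abbreviation "slit \<equiv> V \<times> (- {0 :: real ^ 'n})"
abbreviation "g \<equiv> fundamental_matrix K"
abbreviation "ginv \<equiv> inverse_fundamental_matrix K"

text \<open>
  The spray coefficients are the solution \<open>S\<close> of the linear system \<open>g (2 S) = E\<close>. The function \<open>DK\<close> is the
  derivative of \<open>K\<close> when the base point moves with velocity \<open>y\<close>.
\<close>

abbreviation "DK z \<equiv> (\<Sum>c\<in>UNIV. dx c K z * snd z $ c)"
abbreviation "E b z \<equiv> (\<Sum>c\<in>UNIV. dy b (dx c K) z * snd z $ c) - dx b K z"

lemma open_slit: "open slit" by (rule open_punctured_fibres[OF open_base])

lemma differentiable:
  assumes "z \<in> slit"
  shows "K differentiable (at z)" "dx a K differentiable (at z)" "dy a K differentiable (at z)"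
  using smooth_onD(1)[OF smooth assms] smooth_onD(1)[OF smooth_on_dx[OF smooth] assms]
    smooth_onD(1)[OF smooth_on_dy[OF smooth] assms] .

lemma dx_homogeneous: "y_homogeneous 2 V (dx a K)"
  by (rule y_homogeneous_dx[OF open_base homogeneous differentiable(1)])

lemma dy_homogeneous: "y_homogeneous 1 V (dy a K)"
  using y_homogeneous_dy[OF open_base _ differentiable(1), of 1 a] homogeneous
  by (simp add: numeral_2_eq_2)

lemma euler_K: "z \<in> slit \<Longrightarrow> (\<Sum>b\<in>UNIV. snd z $ b * dy b K z) = 2 * K z"
  using euler_y_homogeneous[OF homogeneous _ _ differentiable(1)] by (cases z) auto

lemma euler_dx: "z \<in> slit \<Longrightarrow> (\<Sum>b\<in>UNIV. snd z $ b * dy b (dx a K) z) = 2 * dx a K z"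
  using euler_y_homogeneous[OF dx_homogeneous _ _ differentiable(2)] by (cases z) auto

lemma y_g: "z \<in> slit \<Longrightarrow> (\<Sum>b\<in>UNIV. snd z $ b * g z $ b $ a) = dy a K z"
  using euler_y_homogeneous[OF dy_homogeneous _ _ differentiable(3)]
  by (cases z) (auto simp: fundamental_matrix_def)

lemma g_y: "z \<in> slit \<Longrightarrow> (\<Sum>b\<in>UNIV. g z $ a $ b * snd z $ b) = dy a K z"
  using euler_dy_y_homogeneous[OF open_base homogeneous smooth]
  by (cases z) (auto simp: fundamental_matrix_def mult.commute)

lemma g_ginv: "z \<in> slit \<Longrightarrow> (\<Sum>b\<in>UNIV. g z $ a $ b * ginv z $ b $ c) = (if a = c then 1 else 0)"
  using matrix_inv_right[of "g z"] nondegenerate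
  by (cases z; auto simp: inverse_fundamental_matrix_def matrix_matrix_mult_def mat_def vec_eq_iff)

lemma dK_ginv:
  assumes "z \<in> slit"
  shows "(\<Sum>b\<in>UNIV. dy b K z * ginv z $ b $ a) = snd z $ a"
proof -
  have "(\<Sum>b\<in>UNIV. dy b K z * ginv z $ b $ a) =
      (\<Sum>b\<in>UNIV. \<Sum>c\<in>UNIV. snd z $ c * (g z $ c $ b * ginv z $ b $ a))"
    by (simp add: y_g[OF assms, symmetric] sum_distrib_right mult.assoc)
  also have "\<dots> = (\<Sum>c\<in>UNIV. snd z $ c * (\<Sum>b\<in>UNIV. g z $ c $ b * ginv z $ b $ a))"
    by (subst sum.swap) (simp add: sum_distrib_left)
  finally show ?thesis by (simp add: g_ginv[OF assms] if_distrib cong: if_cong)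
qed

lemma g_spray:
  assumes "z \<in> slit"
  shows "(\<Sum>b\<in>UNIV. g z $ a $ b * (2 * spray_coeff K b z)) = E a z"
proof -
  have "(\<Sum>b\<in>UNIV. g z $ a $ b * (2 * spray_coeff K b z)) =
      (\<Sum>b\<in>UNIV. \<Sum>c\<in>UNIV. g z $ a $ b * ginv z $ b $ c * E c z)"
    by (simp add: spray_coeff_def sum_distrib_left mult.assoc)
  also have "\<dots> = (\<Sum>c\<in>UNIV. (\<Sum>b\<in>UNIV. g z $ a $ b * ginv z $ b $ c) * E c z)"
    by (subst sum.swap) (simp add: sum_distrib_right)
  finally show ?thesis
    by (simp add: g_ginv[OF assms] if_distrib[of "\<lambda>t. t * _"] cong: if_cong)
qed

text \<open>
  By \<open>y_g\<close>, the left-hand side is \<open>y\<close> contracted with the right-hand side of the system in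
  \<open>g_spray\<close>; Euler's relation for the functions \<open>dx d K\<close>, which have degree 2, turns this
  into \<open>2 DK - DK\<close>.
\<close>

lemma dK_spray:
  assumes "z \<in> slit"
  shows "(\<Sum>b\<in>UNIV. dy b K z * (2 * spray_coeff K b z)) = DK z"
proof -
  have "(\<Sum>b\<in>UNIV. dy b K z * (2 * spray_coeff K b z)) =
      (\<Sum>b\<in>UNIV. \<Sum>c\<in>UNIV. snd z $ c * (g z $ c $ b * (2 * spray_coeff K b z)))"
    by (simp add: y_g[OF assms, symmetric] sum_distrib_right mult.assoc)
  also have "\<dots> = (\<Sum>c\<in>UNIV. snd z $ c * E c z)"
    by (subst sum.swap) (simp add: sum_distrib_left[symmetric] g_spray[OF assms])
  also have "\<dots> = (\<Sum>c\<in>UNIV. \<Sum>d\<in>UNIV. snd z $ c * dy c (dx d K) z * snd z $ d) - DK z"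
    by (simp add: algebra_simps sum_subtractf sum_distrib_left)
  also have "(\<Sum>c\<in>UNIV. \<Sum>d\<in>UNIV. snd z $ c * dy c (dx d K) z * snd z $ d) = 2 * DK z"
    by (subst sum.swap)
      (simp add: sum_distrib_right[symmetric] euler_dx[OF assms], simp add: sum_distrib_left mult.assoc)
  finally show ?thesis by simp
qed

lemma smooth_spray: "smooth_on slit (spray_coeff K a)"
proof -
  have ginv: "smooth_on slit (\<lambda>z. ginv z $ a $ b)" for b
    unfolding inverse_fundamental_matrix_def
    using nondegenerate
    by (intro smooth_on_matrix_inv open_slit)
      (auto simp: fundamental_matrix_def intro!: smooth_on_dy smooth)
  show ?thesis
    unfolding spray_coeff_def[abs_def]
    by (intro smooth_on_mult smooth_on_sum smooth_on_diff smooth_on_const smooth_on_snd_nth ginv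
        open_slit smooth_on_dx smooth_on_dy smooth)
qed

text \<open>
  The fundamental matrix has degree 0, hence so does its inverse, and the bracket in the spray
  coefficients has degree 2.
\<close>

lemma spray_homogeneous: "y_homogeneous 2 V (spray_coeff K a)"
  unfolding y_homogeneous_def
proof (intro ballI allI impI)
  fix x y :: "real ^ 'n" and r :: real assume x: "x \<in> V" and y: "y \<noteq> 0" and r: "r > 0"
  have 1: "y_homogeneous 0 V (dy b (dy c K))" for b c
    using y_homogeneous_dy[OF open_base _ differentiable(3), of 0 c b] dy_homogeneous by simp
  have 2: "y_homogeneous 1 V (dy b (dx c K))" for b c
    using y_homogeneous_dy[OF open_base _ differentiable(2), of 1 c b] dx_homogeneous
    by (simp add: numeral_2_eq_2)
  have "g (x, r *\<^sub>R y) = g (x, y)"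
    using y_homogeneousD[OF 1 x y r] by (simp add: fundamental_matrix_def)
  then have "ginv (x, r *\<^sub>R y) = ginv (x, y)"
    by (simp add: inverse_fundamental_matrix_def)
  then show "spray_coeff K a (x, r *\<^sub>R y) = r\<^sup>2 * spray_coeff K a (x, y)"
    using y_homogeneousD[OF 2 x y r] y_homogeneousD[OF dx_homogeneous x y r]
    by (simp add: spray_coeff_def sum_distrib_left algebra_simps power2_eq_square)
qed

text \<open>
  The derivatives \<open>dy c\<close> of the spray coefficients have degree 1, the degree at which the right-hand
  side of the differentiated Euler relation vanishes.
\<close>

lemma y_berwald:
  assumes "z \<in> slit"
  shows "(\<Sum>b\<in>UNIV. snd z $ b * berwald_curvature K d a b c z) = 0"
proof -
  have "y_homogeneous 1 V (dy c (spray_coeff K d))"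
    using y_homogeneous_dy[OF open_base _ smooth_onD(1)[OF smooth_spray], of 1 d c] spray_homogeneous
    by (simp add: numeral_2_eq_2)
  from euler_dy_y_homogeneous[OF open_base this smooth_on_dy[OF smooth_spray]] assms
  show ?thesis by (cases z) (auto simp: berwald_curvature_def)
qed

lemma landsberg_eq:
  assumes "z \<in> slit"
  shows "landsberg_curvature K a b c z =
    - (1/4) * (\<Sum>d\<in>UNIV. dy d K z * berwald_curvature K d a b c z)"
proof -
  have "(\<Sum>e\<in>UNIV. \<Sum>d\<in>UNIV. snd z $ e * g z $ e $ d * berwald_curvature K d a b c z) =
    (\<Sum>d\<in>UNIV. dy d K z * berwald_curvature K d a b c z)"
    by (subst sum.swap) (simp add: sum_distrib_right[symmetric] y_g[OF assms])
  then show ?thesis by (simp add: landsberg_curvature_def)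
qed

lemma y_landsberg:
  assumes "z \<in> slit"
  shows "(\<Sum>b\<in>UNIV. snd z $ b * landsberg_curvature K a b c z) = 0"
proof -
  have "(\<Sum>b\<in>UNIV. snd z $ b * landsberg_curvature K a b c z) =
     (\<Sum>b\<in>UNIV. \<Sum>d\<in>UNIV. - (1/4) * (dy d K z * (snd z $ b * berwald_curvature K d a b c z)))"
    by (simp add: landsberg_eq[OF assms] sum_distrib_left mult_ac)
  also have "\<dots> = (\<Sum>d\<in>UNIV. - (1/4) * (dy d K z * (\<Sum>b\<in>UNIV. snd z $ b * berwald_curvature K d a b c z)))"
    by (subst sum.swap) (simp add: sum_distrib_left)
  finally show ?thesis by (simp add: y_berwald[OF assms])
qed

text \<open>
  The matrix contracted with \<open>c\<close> times the Landsberg curvature is the diagonal block of the inverse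
  fundamental matrix of a product. The scalar \<open>c\<close> cancels, and the rank one term is invisible
  because \<open>y\<close> annihilates the Landsberg curvature.
\<close>

lemma trace_landsberg:
  assumes z: "z \<in> slit" and "c \<noteq> 0"
  shows "2 * (\<Sum>b\<in>UNIV. \<Sum>d\<in>UNIV. (ginv z $ b $ d / c + k * (snd z $ b * snd z $ d)) *
      (c * landsberg_curvature K a b d z)) = mean_landsberg_curvature K a z"
proof -
  have "(\<Sum>b\<in>UNIV. \<Sum>d\<in>UNIV. (ginv z $ b $ d / c + k * (snd z $ b * snd z $ d)) *
      (c * landsberg_curvature K a b d z)) =
    (\<Sum>b\<in>UNIV. \<Sum>d\<in>UNIV. ginv z $ b $ d * landsberg_curvature K a b d z) +
    (\<Sum>b\<in>UNIV. \<Sum>d\<in>UNIV. k * c * snd z $ d * (snd z $ b * landsberg_curvature K a b d z))"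
    using \<open>c \<noteq> 0\<close> by (simp add: algebra_simps sum.distrib)
  also have "(\<Sum>b\<in>UNIV. \<Sum>d\<in>UNIV. k * c * snd z $ d * (snd z $ b * landsberg_curvature K a b d z)) =
      (\<Sum>d\<in>UNIV. k * c * snd z $ d * (\<Sum>b\<in>UNIV. snd z $ b * landsberg_curvature K a b d z))"
    by (subst sum.swap) (simp add: sum_distrib_left)
  finally show ?thesis by (simp add: y_landsberg[OF z] mean_landsberg_curvature_def)
qed

end

lemma sum_UNIV_sum:
  fixes h :: "'m::finite + 'n::finite \<Rightarrow> 'b::comm_monoid_add"
  shows "(\<Sum>i\<in>UNIV. h i) = (\<Sum>a\<in>UNIV. h (Inl a)) + (\<Sum>j\<in>UNIV. h (Inr j))"
  unfolding UNIV_Plus_UNIV[symmetric] by (simp add: sum.Plus del: UNIV_Plus_UNIV)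

section \<open>Product functions\<close>

text \<open>
  The two consequences of homogeneity on an open cone, as for functions homogeneous in the fibre
  variable: Euler's relation, and the homogeneity of derivatives.
\<close>

lemma frechet_derivative_cone_homogeneous:
  fixes f :: "'a::real_normed_vector \<Rightarrow> real"
  assumes S: "open S" and cone: "\<And>z r. z \<in> S \<Longrightarrow> 0 < r \<Longrightarrow> r *\<^sub>R z \<in> S"
    and f: "\<And>z r. z \<in> S \<Longrightarrow> 0 < r \<Longrightarrow> f (r *\<^sub>R z) = r ^ k * f z"
    and diff: "\<And>z. z \<in> S \<Longrightarrow> f differentiable (at z)"
    and z: "z \<in> S"
  shows "frechet_derivative f (at z) z = real k * f z"
    and "0 < r \<Longrightarrow> frechet_derivative f (at (r *\<^sub>R z)) (r *\<^sub>R v) = r ^ k * frechet_derivative f (at z) v"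
proof -
  have c: "((\<lambda>r::real. r *\<^sub>R z) has_derivative (\<lambda>h. h *\<^sub>R z)) (at 1)"
    by (intro has_derivative_scaleR_left has_derivative_ident)
  have "(f has_derivative frechet_derivative f (at z)) (at (1 *\<^sub>R z))"
    using diff[OF z] by (simp add: frechet_derivative_works)
  from diff_chain_at[OF c this]
  have 1: "((\<lambda>r. f (r *\<^sub>R z)) has_derivative (\<lambda>h. frechet_derivative f (at z) (h *\<^sub>R z))) (at 1)"
    by (simp add: comp_def)
  have "((\<lambda>r. r ^ k * f z) has_derivative (\<lambda>h. h * (real k * f z))) (at 1)"
    using has_derivative_mult_left[OF has_derivative_power[OF has_derivative_ident], of k "f z" 1 UNIV]
    by (simp add: mult_ac)
  then have "((\<lambda>r. f (r *\<^sub>R z)) has_derivative (\<lambda>h. h * (real k * f z))) (at 1)"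
    by (rule has_derivative_transform_within_open[where s = "{0<..}"]) (simp_all add: f[OF z])
  from fun_cong[OF has_derivative_unique[OF 1 this], of 1]
  show "frechet_derivative f (at z) z = real k * f z" by simp
next
  assume r: "0 < r"
  have "frechet_derivative f (at (r *\<^sub>R z)) (r *\<^sub>R v) =
      frechet_derivative (\<lambda>z. f (r *\<^sub>R z)) (at z) v"
    by (rule frechet_derivative_compose_linear[OF bounded_linear_scaleR_right, symmetric])
      (rule diff[OF cone[OF z r]])
  also have "\<dots> = frechet_derivative (\<lambda>z. r ^ k * f z) (at z) v"
    by (rule fun_cong[OF frechet_derivative_cong_open[OF S z]]) (rule f[OF _ r])
  also have "\<dots> = r ^ k * frechet_derivative f (at z) v"
    using diff[OF z] by (subst frechet_derivative_mult) auto
  finally show "frechet_derivative f (at (r *\<^sub>R z)) (r *\<^sub>R v) = r ^ k * frechet_derivative f (at z) v" .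
qed

lemma frechet_derivative_d1_d2:
  assumes "\<phi> differentiable (at z)"
  shows "frechet_derivative \<phi> (at z) v = fst v * d1 \<phi> z + snd v * d2 \<phi> z"
proof -
  have lin: "linear (frechet_derivative \<phi> (at z))"
    using assms by (rule linear_frechet_derivative)
  have "v = fst v *\<^sub>R (1, 0) + snd v *\<^sub>R (0, 1)"
    by (simp add: prod_eq_iff)
  then have "frechet_derivative \<phi> (at z) v =
      frechet_derivative \<phi> (at z) (fst v *\<^sub>R (1, 0) + snd v *\<^sub>R (0, 1))"
    by (rule arg_cong)
  then show ?thesis
    unfolding linear_add[OF lin] linear_cmul[OF lin] d1_def d2_def by simp
qed

context
  fixes f :: "real \<times> real \<Rightarrow> real"
  assumes f: "product_function f"
begin

abbreviation "quadrant \<equiv> {0::real<..} \<times> {0::real<..}"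

lemma open_quadrant: "open quadrant"
  by (intro open_Times) auto

lemma product_function_differentiable:
  assumes "z \<in> quadrant"
  shows "f differentiable (at z)" "d1 f differentiable (at z)" "d2 f differentiable (at z)"
proof -
  have "smooth_on quadrant f" using f by (simp add: product_function_def)
  then show "f differentiable (at z)" "d1 f differentiable (at z)" "d2 f differentiable (at z)"
    using smooth_onD[of quadrant] assms unfolding d1_def[abs_def] d2_def[abs_def] by blast+
qed

lemma product_function_cone:
  assumes "z \<in> quadrant" "0 < r"
  shows "f (r *\<^sub>R z) = r ^ 1 * f z"
  using f assms by (cases z) (auto simp: product_function_def)

lemma quadrant_cone: "z \<in> quadrant \<Longrightarrow> 0 < r \<Longrightarrow> r *\<^sub>R z \<in> quadrant"
  by (cases z) auto

lemma product_function_euler: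
  assumes "0 < s" "0 < t"
  shows "s * d1 f (s, t) + t * d2 f (s, t) = f (s, t)"
  using frechet_derivative_cone_homogeneous(1)[OF open_quadrant quadrant_cone
      product_function_cone product_function_differentiable(1), of "(s, t)"] assms
  by (simp add: frechet_derivative_d1_d2 product_function_differentiable(1))

lemma product_function_partials_cone:
  assumes "z \<in> quadrant" "0 < r"
  shows "d1 f (r *\<^sub>R z) = r ^ 0 * d1 f z" "d2 f (r *\<^sub>R z) = r ^ 0 * d2 f z"
proof -
  have *: "frechet_derivative f (at (r *\<^sub>R z)) v = frechet_derivative f (at z) v" for v
  proof -
    have "linear (frechet_derivative f (at (r *\<^sub>R z)))"
      using product_function_differentiable(1) quadrant_cone[OF assms] by (intro linear_frechet_derivative)
    from linear_cmul[OF this, of r v] show ?thesis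
      using frechet_derivative_cone_homogeneous(2)[OF open_quadrant quadrant_cone
        product_function_cone product_function_differentiable(1) assms, of v] assms(2) by simp
  qed
  show "d1 f (r *\<^sub>R z) = r ^ 0 * d1 f z" "d2 f (r *\<^sub>R z) = r ^ 0 * d2 f z"
    by (simp_all add: d1_def d2_def *)
qed

lemma product_function_second_euler:
  assumes "0 < s" "0 < t"
  shows "s * d1 (d1 f) (s, t) + t * d2 (d1 f) (s, t) = 0"
    and "s * d1 (d2 f) (s, t) + t * d2 (d2 f) (s, t) = 0"
  using frechet_derivative_cone_homogeneous(1)[OF open_quadrant quadrant_cone
      product_function_partials_cone(1) product_function_differentiable(2), of "(s, t)"]
    frechet_derivative_cone_homogeneous(1)[OF open_quadrant quadrant_cone
      product_function_partials_cone(2) product_function_differentiable(3), of "(s, t)"] assms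
  by (simp_all add: frechet_derivative_d1_d2 product_function_differentiable(2,3))

text \<open>
  Euler's relation for \<open>d1 f\<close>, which is homogeneous of degree 0, involves \<open>d2 (d1 f)\<close>, whereas
  differentiating Euler's relation for \<open>f\<close> produces \<open>d1 (d2 f)\<close>. Comparison of the two gives the symmetry.
\<close>

lemma product_function_mixed_partials:
  assumes "0 < s" "0 < t"
  shows "d2 (d1 f) (s, t) = d1 (d2 f) (s, t)"
proof -
  have z: "(s, t) \<in> quadrant" using assms by simp
  have fst: "fst differentiable (at z)" "frechet_derivative fst (at z) = fst" for z :: "real \<times> real"
    using bounded_linear_imp_differentiable bounded_linear_fst frechet_derivative_bounded_linear by blast+
  have snd: "snd differentiable (at z)" "frechet_derivative snd (at z) = snd" for z :: "real \<times> real"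
    using bounded_linear_imp_differentiable bounded_linear_snd frechet_derivative_bounded_linear by blast+
  note diff = product_function_differentiable[OF z]
  have "d1 f (s, t) = frechet_derivative (\<lambda>z. fst z * d1 f z + snd z * d2 f z) (at (s, t)) (1, 0)"
    unfolding d1_def[of f "(s, t)"]
    by (rule fun_cong[OF frechet_derivative_cong_open[OF open_quadrant z]])
      (auto simp: product_function_euler)
  also have "\<dots> = d1 f (s, t) + s * d1 (d1 f) (s, t) + t * d1 (d2 f) (s, t)"
    using diff fst snd
    by (subst frechet_derivative_plus)
      (auto simp: frechet_derivative_mult d1_def[of "d1 f"] d1_def[of "d2 f"])
  finally have "s * d1 (d1 f) (s, t) + t * d1 (d2 f) (s, t) = 0" by simp
  with product_function_second_euler(1)[OF assms]
  have "t * d2 (d1 f) (s, t) = t * d1 (d2 f) (s, t)" by linarith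
  with assms show ?thesis by simp
qed

end

section \<open>Product coordinates\<close>

definition vec_fst :: "real ^ ('m::finite + 'n::finite) \<Rightarrow> real ^ 'm"
  where "vec_fst v = (\<chi> a. v $ Inl a)"

definition vec_snd :: "real ^ ('m::finite + 'n::finite) \<Rightarrow> real ^ 'n"
  where "vec_snd v = (\<chi> a. v $ Inr a)"

definition coords_fst :: "('m::finite + 'n::finite) coords \<Rightarrow> 'm coords"
  where "coords_fst z = (vec_fst (fst z), vec_fst (snd z))"

definition coords_snd :: "('m::finite + 'n::finite) coords \<Rightarrow> 'n coords"
  where "coords_snd z = (vec_snd (fst z), vec_snd (snd z))"

lemma bounded_linear_coords_fst: "bounded_linear coords_fst"
  unfolding coords_fst_def vec_fst_def
  by (intro linear_conv_bounded_linear[THEN iffD1] linearI) (auto simp: vec_eq_iff)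

lemma bounded_linear_coords_snd: "bounded_linear coords_snd"
  unfolding coords_snd_def vec_snd_def
  by (intro linear_conv_bounded_linear[THEN iffD1] linearI) (auto simp: vec_eq_iff)

lemma coords_fst_axis [simp]:
  "coords_fst (0, axis (Inl a) 1) = (0, axis a 1)" "coords_fst (axis (Inl a) 1, 0) = (axis a 1, 0)"
  "coords_fst (0, axis (Inr i) 1) = 0" "coords_fst (axis (Inr i) 1, 0) = 0"
  by (auto simp: coords_fst_def vec_fst_def axis_def vec_eq_iff prod_eq_iff)

lemma coords_snd_axis [simp]:
  "coords_snd (0, axis (Inr a) 1) = (0, axis a 1)" "coords_snd (axis (Inr a) 1, 0) = (axis a 1, 0)"
  "coords_snd (0, axis (Inl i) 1) = 0" "coords_snd (axis (Inl i) 1, 0) = 0"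
  by (auto simp: coords_snd_def vec_snd_def axis_def vec_eq_iff prod_eq_iff)

lemma snd_coords_nth [simp]:
  "snd (coords_fst z) $ a = snd z $ Inl a" "snd (coords_snd z) $ i = snd z $ Inr i"
  by (simp_all add: coords_fst_def coords_snd_def vec_fst_def vec_snd_def)

lemma differentiable_coords_fst:
  assumes "h differentiable (at (coords_fst z))"
  shows "(\<lambda>z. h (coords_fst z)) differentiable (at z)"
  using differentiable_chain_at[OF bounded_linear_imp_differentiable[OF bounded_linear_coords_fst] assms]
  by (simp add: comp_def)

lemma differentiable_coords_snd:
  assumes "h differentiable (at (coords_snd z))"
  shows "(\<lambda>z. h (coords_snd z)) differentiable (at z)"
  using differentiable_chain_at[OF bounded_linear_imp_differentiable[OF bounded_linear_coords_snd] assms]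
  by (simp add: comp_def)

lemma dy_coords_fst:
  assumes "h differentiable (at (coords_fst z))"
  shows "dy (Inl a) (\<lambda>z. h (coords_fst z)) z = dy a h (coords_fst z)"
    and "dy (Inr i) (\<lambda>z. h (coords_fst z)) z = 0"
  using linear_0[OF linear_frechet_derivative[OF assms]]
  by (simp_all add: dy_def frechet_derivative_compose_linear[OF bounded_linear_coords_fst assms])

lemma dy_coords_snd:
  assumes "h differentiable (at (coords_snd z))"
  shows "dy (Inr i) (\<lambda>z. h (coords_snd z)) z = dy i h (coords_snd z)"
    and "dy (Inl a) (\<lambda>z. h (coords_snd z)) z = 0"
  using linear_0[OF linear_frechet_derivative[OF assms]]
  by (simp_all add: dy_def frechet_derivative_compose_linear[OF bounded_linear_coords_snd assms])

section \<open>The block inverse\<close>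

text \<open>
  A row of a combination of \<open>m\<close> and a rank one matrix, multiplied by a column of a combination of \<open>n\<close>
  and another rank one matrix.
\<close>

lemma sum_rank_one_times_rank_one:
  fixes p m n y :: "'i \<Rightarrow> real"
  shows "(\<Sum>b\<in>I. (P * p b + Q * m b) * (R * n b + S * y b)) =
    P * R * (\<Sum>b\<in>I. p b * n b) + P * S * (\<Sum>b\<in>I. y b * p b)
    + Q * R * (\<Sum>b\<in>I. m b * n b) + Q * S * (\<Sum>b\<in>I. m b * y b)"
  by (simp add: algebra_simps sum.distrib sum_distrib_left)

text \<open>
  Multiply the fundamental matrix of a product by a matrix of the form proposed for its inverse: each of
  the four blocks of the result is a rank one matrix, apart from the identity on the diagonal, and the
  identities say that its coefficient vanishes. The unknowns \<open>\<alpha>\<close>, \<open>\<beta>\<close>, \<open>\<gamma>\<close> are the coefficients of the rank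
  one terms of the inverse. By the first and third identity, \<open>(\<alpha>, \<beta>)\<close> solves a system
  with matrix \<open>(fs - 2 t e, 2 t e; 2 s e, ft - 2 s e)\<close>, whose determinant is \<open>\<Delta>\<close>. The second and fourth
  give a system for \<open>(\<beta>, \<gamma>)\<close> with the same matrix.
\<close>

lemma block_inverse_coefficients:
  fixes s t fs ft fss e ftt :: real
  assumes "s > 0" "t > 0" "fs \<noteq> 0" "ft \<noteq> 0"
    and "s * fss + t * e = 0" "s * e + t * ftt = 0"
    and \<Delta>: "\<Delta> = fs * ft - 2 * (s * fs + t * ft) * e" "\<Delta> \<noteq> 0"
    and "\<alpha> = t * e * ft / (s * fs * \<Delta>)" "\<beta> = - e / \<Delta>" "\<gamma> = s * e * fs / (t * ft * \<Delta>)"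
  shows "fss / fs + 2 * s * fss * \<alpha> + fs * \<alpha> + 2 * t * e * \<beta> = 0"
    and "2 * s * fss * \<beta> + fs * \<beta> + e / ft + 2 * t * e * \<gamma> = 0"
    and "e / fs + 2 * s * e * \<alpha> + 2 * t * ftt * \<beta> + ft * \<beta> = 0"
    and "ftt / ft + 2 * t * ftt * \<gamma> + ft * \<gamma> + 2 * s * e * \<beta> = 0"
proof -
  have f: "fss = - t * e / s" "ftt = - s * e / t"
    using assms(1,2,5,6) by (simp_all add: field_simps)
  note eqs = assms(9-11) f
  show "fss / fs + 2 * s * fss * \<alpha> + fs * \<alpha> + 2 * t * e * \<beta> = 0"
    unfolding eqs using assms(1-4) \<Delta>(2)
    by (simp add: divide_simps) (simp add: \<Delta>(1) algebra_simps)
  show "2 * s * fss * \<beta> + fs * \<beta> + e / ft + 2 * t * e * \<gamma> = 0"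
    unfolding eqs using assms(1-4) \<Delta>(2)
    by (simp add: divide_simps) (simp add: \<Delta>(1) algebra_simps)
  show "e / fs + 2 * s * e * \<alpha> + 2 * t * ftt * \<beta> + ft * \<beta> = 0"
    unfolding eqs using assms(1-4) \<Delta>(2)
    by (simp add: divide_simps) (simp add: \<Delta>(1) algebra_simps)
  show "ftt / ft + 2 * t * ftt * \<gamma> + ft * \<gamma> + 2 * s * e * \<beta> = 0"
    unfolding eqs using assms(1-4) \<Delta>(2)
    by (simp add: divide_simps) (simp add: \<Delta>(1) algebra_simps)
qed

section \<open>Products in a chart\<close>

locale product_chart = M1: finsler_chart V K + M2: finsler_chart V' H
  for V :: "(real ^ 'm::finite) set" and K and V' :: "(real ^ 'n::finite) set" and H +
  fixes f :: "real \<times> real \<Rightarrow> real" and G :: "('m + 'n) coords \<Rightarrow> real"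
  assumes f: "product_function f"
    and G: "coords_fst z \<in> M1.slit \<Longrightarrow> coords_snd z \<in> M2.slit \<Longrightarrow>
      G z = f (K (coords_fst z), H (coords_snd z))"
begin

definition "slit = {z :: ('m + 'n) coords. coords_fst z \<in> M1.slit \<and> coords_snd z \<in> M2.slit}"

definition "KH z = (K (coords_fst z), H (coords_snd z))"

lemma slitD: "z \<in> slit \<Longrightarrow> coords_fst z \<in> M1.slit" "z \<in> slit \<Longrightarrow> coords_snd z \<in> M2.slit"
  by (simp_all add: slit_def)

lemma open_slit: "open slit"
proof -
  have "slit = coords_fst -` M1.slit \<inter> coords_snd -` M2.slit"
    by (auto simp: slit_def)
  then show ?thesis
    using M1.open_slit M2.open_slit bounded_linear_coords_fst bounded_linear_coords_snd
    by (auto intro!: open_Int open_vimage linear_continuous_on)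
qed

lemma KH_quadrant: "z \<in> slit \<Longrightarrow> KH z \<in> {0<..} \<times> {0<..}"
  using M1.positive M2.positive
  by (cases "coords_fst z"; cases "coords_snd z") (auto simp: slit_def KH_def)

lemma KH_differentiable:
  assumes "z \<in> slit" "\<phi> differentiable (at (KH z))"
  shows "(\<lambda>z. \<phi> (KH z)) differentiable (at z)"
    and "frechet_derivative (\<lambda>z. \<phi> (KH z)) (at z) v =
      d1 \<phi> (KH z) * frechet_derivative K (at (coords_fst z)) (coords_fst v) +
      d2 \<phi> (KH z) * frechet_derivative H (at (coords_snd z)) (coords_snd v)"
proof -
  have "((\<lambda>z. K (coords_fst z)) has_derivative
      (\<lambda>v. frechet_derivative K (at (coords_fst z)) (coords_fst v))) (at z)"
    using diff_chain_at[OF bounded_linear.has_derivative[OF bounded_linear_coords_fst has_derivative_ident],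
        of K "frechet_derivative K (at (coords_fst z))" z]
      M1.differentiable(1)[OF slitD(1)[OF assms(1)]]
    by (simp add: comp_def frechet_derivative_works)
  moreover have "((\<lambda>z. H (coords_snd z)) has_derivative
      (\<lambda>v. frechet_derivative H (at (coords_snd z)) (coords_snd v))) (at z)"
    using diff_chain_at[OF bounded_linear.has_derivative[OF bounded_linear_coords_snd has_derivative_ident],
        of H "frechet_derivative H (at (coords_snd z))" z]
      M2.differentiable(1)[OF slitD(2)[OF assms(1)]]
    by (simp add: comp_def frechet_derivative_works)
  ultimately have KH: "(KH has_derivative (\<lambda>v. (frechet_derivative K (at (coords_fst z)) (coords_fst v),
      frechet_derivative H (at (coords_snd z)) (coords_snd v)))) (at z)"
    unfolding KH_def[abs_def] by (rule has_derivative_Pair)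
  have "(\<phi> has_derivative frechet_derivative \<phi> (at (KH z))) (at (KH z))"
    using assms(2) by (simp add: frechet_derivative_works)
  from diff_chain_at[OF KH this]
  have D: "((\<lambda>z. \<phi> (KH z)) has_derivative
      (\<lambda>v. d1 \<phi> (KH z) * frechet_derivative K (at (coords_fst z)) (coords_fst v) +
      d2 \<phi> (KH z) * frechet_derivative H (at (coords_snd z)) (coords_snd v))) (at z)"
    by (simp add: comp_def frechet_derivative_d1_d2[OF assms(2)] mult.commute)
  then show "(\<lambda>z. \<phi> (KH z)) differentiable (at z)" by (auto simp: differentiable_def)
  show "frechet_derivative (\<lambda>z. \<phi> (KH z)) (at z) v =
      d1 \<phi> (KH z) * frechet_derivative K (at (coords_fst z)) (coords_fst v) +
      d2 \<phi> (KH z) * frechet_derivative H (at (coords_snd z)) (coords_snd v)"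
    using fun_cong[OF frechet_derivative_at[OF D], of v] by simp
qed

lemma frechet_zero:
  assumes "z \<in> slit"
  shows "frechet_derivative K (at (coords_fst z)) 0 = 0" "frechet_derivative H (at (coords_snd z)) 0 = 0"
  using linear_0[OF linear_frechet_derivative[OF M1.differentiable(1)[OF slitD(1)[OF assms]]]]
    linear_0[OF linear_frechet_derivative[OF M2.differentiable(1)[OF slitD(2)[OF assms]]]] .

lemma f_differentiable:
  assumes "z \<in> slit"
  shows "f differentiable (at (KH z))" "d1 f differentiable (at (KH z))" "d2 f differentiable (at (KH z))"
  using product_function_differentiable[OF f KH_quadrant[OF assms]] .

lemma G_derivative:
  assumes "z \<in> slit"
  shows "dy (Inl a) G z = d1 f (KH z) * dy a K (coords_fst z)"
    and "dy (Inr i) G z = d2 f (KH z) * dy i H (coords_snd z)"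
    and "dx (Inl a) G z = d1 f (KH z) * dx a K (coords_fst z)"
    and "dx (Inr i) G z = d2 f (KH z) * dx i H (coords_snd z)"
proof -
  have *: "frechet_derivative G (at z) = frechet_derivative (\<lambda>z. f (KH z)) (at z)"
    by (rule frechet_derivative_cong_open[OF open_slit assms])
      (simp add: G KH_def slitD)
  show "dy (Inl a) G z = d1 f (KH z) * dy a K (coords_fst z)"
    and "dy (Inr i) G z = d2 f (KH z) * dy i H (coords_snd z)"
    and "dx (Inl a) G z = d1 f (KH z) * dx a K (coords_fst z)"
    and "dx (Inr i) G z = d2 f (KH z) * dx i H (coords_snd z)"
    using frechet_zero[OF assms]
    by (simp_all add: dy_def dx_def * KH_differentiable(2)[OF assms f_differentiable(1)[OF assms]])
qed

text \<open>
  The first derivatives of \<open>G\<close> are functions of \<open>(K, H)\<close> times functions of one factor. The second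
  derivatives in the fundamental matrix and in the spray are obtained by differentiating such products.
\<close>

lemma dy_KH_times:
  assumes z: "z \<in> slit" and \<phi>: "\<phi> differentiable (at (KH z))"
    and F: "\<And>z. z \<in> slit \<Longrightarrow> F z = \<phi> (KH z) * u z" and u: "u differentiable (at z)"
  shows "dy (Inl a) F z = \<phi> (KH z) * dy (Inl a) u z + d1 \<phi> (KH z) * dy a K (coords_fst z) * u z"
    and "dy (Inr i) F z = \<phi> (KH z) * dy (Inr i) u z + d2 \<phi> (KH z) * dy i H (coords_snd z) * u z"
proof -
  have "dy \<nu> F z = \<phi> (KH z) * dy \<nu> u z + frechet_derivative (\<lambda>z. \<phi> (KH z)) (at z) (0, axis \<nu> 1) * u z"
    for \<nu>
  proof -
    have "dy \<nu> F z = dy \<nu> (\<lambda>z. \<phi> (KH z) * u z) z"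
      by (rule dy_cong[OF open_slit z F])
    then show ?thesis
      by (simp add: dy_def frechet_derivative_mult[OF KH_differentiable(1)[OF z \<phi>] u])
  qed
  then show "dy (Inl a) F z = \<phi> (KH z) * dy (Inl a) u z + d1 \<phi> (KH z) * dy a K (coords_fst z) * u z"
    and "dy (Inr i) F z = \<phi> (KH z) * dy (Inr i) u z + d2 \<phi> (KH z) * dy i H (coords_snd z) * u z"
    using frechet_zero[OF z] by (simp_all add: KH_differentiable(2)[OF z \<phi>] dy_def)
qed

lemma second_derivative_fst:
  assumes z: "z \<in> slit" and F: "\<And>z. z \<in> slit \<Longrightarrow> F z = d1 f (KH z) * u (coords_fst z)"
    and u: "u differentiable (at (coords_fst z))"
  shows "dy (Inl a) F z = d1 f (KH z) * dy a u (coords_fst z)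
      + d1 (d1 f) (KH z) * dy a K (coords_fst z) * u (coords_fst z)"
    and "dy (Inr i) F z = d1 (d2 f) (KH z) * dy i H (coords_snd z) * u (coords_fst z)"
  using dy_KH_times[OF z f_differentiable(2)[OF z] F differentiable_coords_fst[OF u]]
    product_function_mixed_partials[OF f, of "fst (KH z)" "snd (KH z)"] KH_quadrant[OF z]
  by (auto simp: dy_coords_fst[OF u] mem_Times_iff)

lemma second_derivative_snd:
  assumes z: "z \<in> slit" and F: "\<And>z. z \<in> slit \<Longrightarrow> F z = d2 f (KH z) * u (coords_snd z)"
    and u: "u differentiable (at (coords_snd z))"
  shows "dy (Inr i) F z = d2 f (KH z) * dy i u (coords_snd z)
      + d2 (d2 f) (KH z) * dy i H (coords_snd z) * u (coords_snd z)"
    and "dy (Inl a) F z = d1 (d2 f) (KH z) * dy a K (coords_fst z) * u (coords_snd z)"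
  using dy_KH_times[OF z f_differentiable(3)[OF z] F differentiable_coords_snd[OF u]]
  by (auto simp: dy_coords_snd[OF u])

lemma fundamental_matrix_product:
  assumes z: "z \<in> slit"
  shows "fundamental_matrix G z $ Inl a $ Inl b =
      d1 (d1 f) (KH z) * dy a K (coords_fst z) * dy b K (coords_fst z)
      + d1 f (KH z) * M1.g (coords_fst z) $ a $ b"
    and "fundamental_matrix G z $ Inl a $ Inr j =
      d1 (d2 f) (KH z) * dy a K (coords_fst z) * dy j H (coords_snd z)"
    and "fundamental_matrix G z $ Inr i $ Inl b =
      d1 (d2 f) (KH z) * dy i H (coords_snd z) * dy b K (coords_fst z)"
    and "fundamental_matrix G z $ Inr i $ Inr j =
      d2 (d2 f) (KH z) * dy i H (coords_snd z) * dy j H (coords_snd z)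
      + d2 f (KH z) * M2.g (coords_snd z) $ i $ j"
  using second_derivative_fst[OF z G_derivative(1) M1.differentiable(3)[OF slitD(1)[OF z]]]
    second_derivative_snd[OF z G_derivative(2) M2.differentiable(3)[OF slitD(2)[OF z]]]
  by (simp_all add: fundamental_matrix_def)

lemma dy_dx_product:
  assumes z: "z \<in> slit"
  shows "dy (Inl a) (dx (Inl b) G) z =
      d1 (d1 f) (KH z) * dy a K (coords_fst z) * dx b K (coords_fst z)
      + d1 f (KH z) * dy a (dx b K) (coords_fst z)"
    and "dy (Inl a) (dx (Inr j) G) z =
      d1 (d2 f) (KH z) * dy a K (coords_fst z) * dx j H (coords_snd z)"
    and "dy (Inr i) (dx (Inl b) G) z =
      d1 (d2 f) (KH z) * dy i H (coords_snd z) * dx b K (coords_fst z)"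
    and "dy (Inr i) (dx (Inr j) G) z =
      d2 (d2 f) (KH z) * dy i H (coords_snd z) * dx j H (coords_snd z)
      + d2 f (KH z) * dy i (dx j H) (coords_snd z)"
  using second_derivative_fst[OF z G_derivative(3) M1.differentiable(2)[OF slitD(1)[OF z]]]
    second_derivative_snd[OF z G_derivative(4) M2.differentiable(2)[OF slitD(2)[OF z]]]
  by simp_all

text \<open>
  The inverse is the block matrix with diagonal blocks \<open>ginv / f\<^sub>s + \<alpha> y y\<^sup>T\<close> and \<open>ginv / f\<^sub>t + \<gamma> w w\<^sup>T\<close> and
  off-diagonal blocks \<open>\<beta> y w\<^sup>T\<close> and \<open>\<beta> w y\<^sup>T\<close>. Only the diagonal blocks meet nonzero components of the
  Landsberg curvature, so the statement records these alone and leaves \<open>\<alpha>\<close> and \<open>\<gamma>\<close> unspecified.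
\<close>

lemma inverse_fundamental_matrix_product:
  assumes z: "z \<in> slit"
  obtains \<alpha> \<gamma> where "invertible (fundamental_matrix G z)"
    and "\<And>a b. inverse_fundamental_matrix G z $ Inl a $ Inl b =
      M1.ginv (coords_fst z) $ a $ b / d1 f (KH z) + \<alpha> * (snd z $ Inl a * snd z $ Inl b)"
    and "\<And>i j. inverse_fundamental_matrix G z $ Inr i $ Inr j =
      M2.ginv (coords_snd z) $ i $ j / d2 f (KH z) + \<gamma> * (snd z $ Inr i * snd z $ Inr j)"
proof -
  define x where "x = coords_fst z"
  define w where "w = coords_snd z"
  define s where "s = K x"
  define t where "t = H w"
  define fs where "fs = d1 f (KH z)"
  define ft where "ft = d2 f (KH z)"
  define fss where "fss = d1 (d1 f) (KH z)"
  define e where "e = d1 (d2 f) (KH z)"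
  define ftt where "ftt = d2 (d2 f) (KH z)"
  define \<Delta> where "\<Delta> = fs * ft - 2 * (s * fs + t * ft) * e"
  define \<alpha> where "\<alpha> = t * e * ft / (s * fs * \<Delta>)"
  define \<beta> where "\<beta> = - e / \<Delta>"
  define \<gamma> where "\<gamma> = s * e * fs / (t * ft * \<Delta>)"
  have KH: "KH z = (s, t)" by (simp add: KH_def s_def t_def x_def w_def)
  have x: "x \<in> M1.slit" and w: "w \<in> M2.slit" using slitD[OF z] by (simp_all add: x_def w_def)
  have st: "0 < s" "0 < t" using KH_quadrant[OF z] by (simp_all add: KH)
  have fs_ft: "fs \<noteq> 0" "ft \<noteq> 0"
    using f st by (simp_all add: product_function_def fs_def ft_def KH)
  have second: "s * fss + t * e = 0" "s * e + t * ftt = 0"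
    using product_function_second_euler[OF f st] product_function_mixed_partials[OF f st]
    by (simp_all add: fss_def e_def ftt_def KH)
  have "fs * ft - 2 * f (s, t) * e \<noteq> 0"
    using f st by (simp add: product_function_def fs_def ft_def e_def KH)
  then have \<Delta>: "\<Delta> \<noteq> 0"
    using product_function_euler[OF f st] by (simp add: \<Delta>_def fs_def ft_def KH)
  note coeff = block_inverse_coefficients[OF st fs_ft second \<Delta>_def \<Delta> \<alpha>_def \<beta>_def \<gamma>_def]
  define R :: "real ^ ('m + 'n) ^ ('m + 'n)" where "R = (\<chi> \<mu> \<nu>. case \<mu> of
      Inl a \<Rightarrow> (case \<nu> of
        Inl b \<Rightarrow> M1.ginv x $ a $ b / fs + \<alpha> * (snd x $ a * snd x $ b)
      | Inr j \<Rightarrow> \<beta> * (snd x $ a * snd w $ j))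
    | Inr i \<Rightarrow> (case \<nu> of
        Inl b \<Rightarrow> \<beta> * (snd w $ i * snd x $ b)
      | Inr j \<Rightarrow> M2.ginv w $ i $ j / ft + \<gamma> * (snd w $ i * snd w $ j)))"
  note P = fundamental_matrix_product[OF z, folded x_def w_def fs_def ft_def fss_def e_def ftt_def]
  note s1 = M1.dK_ginv[OF x] M1.euler_K[OF x, folded s_def] M1.g_ginv[OF x] M1.g_y[OF x]
  note s2 = M2.dK_ginv[OF w] M2.euler_K[OF w, folded t_def] M2.g_ginv[OF w] M2.g_y[OF w]
  have sum1: "(\<Sum>b\<in>UNIV. (A * dy b K x + B * M1.g x $ a $ b) * (C * M1.ginv x $ b $ c + D * snd x $ b)) =
     A * C * snd x $ c + 2 * A * D * s + B * C * (if a = c then 1 else 0) + B * D * dy a K x"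
    for A B C D a c
    by (simp only: sum_rank_one_times_rank_one s1)
  have sum2: "(\<Sum>b\<in>UNIV. (A * dy b H w + B * M2.g w $ a $ b) * (C * M2.ginv w $ b $ c + D * snd w $ b)) =
     A * C * snd w $ c + 2 * A * D * t + B * C * (if a = c then 1 else 0) + B * D * dy a H w"
    for A B C D a c
    by (simp only: sum_rank_one_times_rank_one s2)
  have "fundamental_matrix G z ** R = mat 1"
  proof -
    \<comment> \<open>In \<open>sum1\<close> and \<open>sum2\<close> the coefficient of \<open>g\<close> or \<open>ginv\<close> is \<open>0\<close> for the off-diagonal blocks. The
      index belonging to it is then arbitrary; \<open>a0\<close> and \<open>i0\<close> fill the places for which no index is at hand.\<close>
    fix a0 :: 'm and i0 :: 'n
    have "(fundamental_matrix G z ** R) $ \<mu> $ \<nu> = mat 1 $ \<mu> $ \<nu>" for \<mu> \<nu>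
    proof (cases \<mu>; cases \<nu>)
      fix a c assume \<mu>\<nu>: "\<mu> = Inl a" "\<nu> = Inl c"
      have "(fundamental_matrix G z ** R) $ \<mu> $ \<nu> =
          (\<Sum>b\<in>UNIV. ((fss * dy a K x) * dy b K x + fs * M1.g x $ a $ b) * ((1 / fs) * M1.ginv x $ b $ c + (\<alpha> * snd x $ c) * snd x $ b)) +
          (\<Sum>j\<in>UNIV. ((e * dy a K x) * dy j H w + 0 * M2.g w $ i0 $ j) * (0 * M2.ginv w $ j $ i0 + (\<beta> * snd x $ c) * snd w $ j))"
        by (simp add: \<mu>\<nu> matrix_matrix_mult_def sum_UNIV_sum P R_def mult_ac)
      also have "\<dots> = dy a K x * snd x $ c * (fss / fs + 2 * s * fss * \<alpha> + fs * \<alpha> + 2 * t * e * \<beta>) + (if a = c then 1 else 0)"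
        unfolding sum1 sum2 using fs_ft by (simp add: algebra_simps)
      also have "\<dots> = mat 1 $ \<mu> $ \<nu>"
        unfolding coeff by (simp add: \<mu>\<nu> mat_def)
      finally show ?thesis .
    next
      fix a k assume \<mu>\<nu>: "\<mu> = Inl a" "\<nu> = Inr k"
      have "(fundamental_matrix G z ** R) $ \<mu> $ \<nu> =
          (\<Sum>b\<in>UNIV. ((fss * dy a K x) * dy b K x + fs * M1.g x $ a $ b) * (0 * M1.ginv x $ b $ a + (\<beta> * snd w $ k) * snd x $ b)) +
          (\<Sum>j\<in>UNIV. ((e * dy a K x) * dy j H w + 0 * M2.g w $ k $ j) * ((1 / ft) * M2.ginv w $ j $ k + (\<gamma> * snd w $ k) * snd w $ j))"
        by (simp add: \<mu>\<nu> matrix_matrix_mult_def sum_UNIV_sum P R_def mult_ac)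
      also have "\<dots> = dy a K x * snd w $ k * (2 * s * fss * \<beta> + fs * \<beta> + e / ft + 2 * t * e * \<gamma>) + 0"
        unfolding sum1 sum2 using fs_ft by (simp add: algebra_simps)
      also have "\<dots> = mat 1 $ \<mu> $ \<nu>"
        unfolding coeff by (simp add: \<mu>\<nu> mat_def)
      finally show ?thesis .
    next
      fix i c assume \<mu>\<nu>: "\<mu> = Inr i" "\<nu> = Inl c"
      have "(fundamental_matrix G z ** R) $ \<mu> $ \<nu> =
          (\<Sum>b\<in>UNIV. ((e * dy i H w) * dy b K x + 0 * M1.g x $ c $ b) * ((1 / fs) * M1.ginv x $ b $ c + (\<alpha> * snd x $ c) * snd x $ b)) +
          (\<Sum>j\<in>UNIV. ((ftt * dy i H w) * dy j H w + ft * M2.g w $ i $ j) * (0 * M2.ginv w $ j $ i + (\<beta> * snd x $ c) * snd w $ j))"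
        by (simp add: \<mu>\<nu> matrix_matrix_mult_def sum_UNIV_sum P R_def mult_ac)
      also have "\<dots> = dy i H w * snd x $ c * (e / fs + 2 * s * e * \<alpha> + 2 * t * ftt * \<beta> + ft * \<beta>) + 0"
        unfolding sum1 sum2 using fs_ft by (simp add: algebra_simps)
      also have "\<dots> = mat 1 $ \<mu> $ \<nu>"
        unfolding coeff by (simp add: \<mu>\<nu> mat_def)
      finally show ?thesis .
    next
      fix i k assume \<mu>\<nu>: "\<mu> = Inr i" "\<nu> = Inr k"
      have "(fundamental_matrix G z ** R) $ \<mu> $ \<nu> =
          (\<Sum>b\<in>UNIV. ((e * dy i H w) * dy b K x + 0 * M1.g x $ a0 $ b) * (0 * M1.ginv x $ b $ a0 + (\<beta> * snd w $ k) * snd x $ b)) +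
          (\<Sum>j\<in>UNIV. ((ftt * dy i H w) * dy j H w + ft * M2.g w $ i $ j) * ((1 / ft) * M2.ginv w $ j $ k + (\<gamma> * snd w $ k) * snd w $ j))"
        by (simp add: \<mu>\<nu> matrix_matrix_mult_def sum_UNIV_sum P R_def mult_ac)
      also have "\<dots> = dy i H w * snd w $ k * (ftt / ft + 2 * t * ftt * \<gamma> + ft * \<gamma> + 2 * s * e * \<beta>) + (if i = k then 1 else 0)"
        unfolding sum1 sum2 using fs_ft by (simp add: algebra_simps)
      also have "\<dots> = mat 1 $ \<mu> $ \<nu>"
        unfolding coeff by (simp add: \<mu>\<nu> mat_def)
      finally show ?thesis .
    qed
    then show ?thesis by (simp add: vec_eq_iff)
  qed
  note * = right_inverse_invertible[OF this] matrix_inv_eq_right_inverse[OF this]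
  show ?thesis
    by (rule that[of \<alpha> \<gamma>])
      (use * in \<open>simp_all add: inverse_fundamental_matrix_def R_def x_def w_def fs_def ft_def\<close>)
qed

text \<open>
  With \<open>S\<close> the vector of doubled spray coefficients of the factors, \<open>g_spray\<close> and \<open>dK_spray\<close> evaluate the
  fundamental matrix of \<open>G\<close> on \<open>S\<close>, and the result is the right-hand side of the system for the spray
  coefficients of \<open>G\<close>. Since the matrix is invertible, \<open>S\<close> is the only solution.
\<close>

lemma spray_coeff_product:
  assumes z: "z \<in> slit"
  shows "spray_coeff G (Inl a) z = spray_coeff K a (coords_fst z)"
    and "spray_coeff G (Inr i) z = spray_coeff H i (coords_snd z)"
proof -
  define x where "x = coords_fst z"
  define w where "w = coords_snd z"
  have x: "x \<in> M1.slit" and w: "w \<in> M2.slit" using slitD[OF z] by (simp_all add: x_def w_def)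
  define S :: "real ^ ('m + 'n)" where
    "S = (\<chi> \<nu>. case \<nu> of Inl b \<Rightarrow> 2 * spray_coeff K b x | Inr j \<Rightarrow> 2 * spray_coeff H j w)"
  define Y :: "real ^ ('m + 'n)" where
    "Y = (\<chi> \<nu>. (\<Sum>\<gamma>\<in>UNIV. dy \<nu> (dx \<gamma> G) z * snd z $ \<gamma>) - dx \<nu> G z)"
  note P = fundamental_matrix_product[OF z, folded x_def w_def]
  note X = dy_dx_product[OF z, folded x_def w_def] G_derivative(3,4)[OF z, folded x_def w_def]
  have snd_z: "snd z $ Inl b = snd x $ b" "snd z $ Inr j = snd w $ j" for b j
    by (simp_all add: x_def w_def)
  have "(fundamental_matrix G z *v S) $ \<nu> = Y $ \<nu>" for \<nu>
  proof (cases \<nu>)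
    case (Inl a)
    have "(fundamental_matrix G z *v S) $ \<nu> =
        d1 (d1 f) (KH z) * dy a K x * M1.DK x + d1 f (KH z) * M1.E a x
        + d1 (d2 f) (KH z) * dy a K x * M2.DK w"
      unfolding M1.dK_spray[OF x, symmetric] M1.g_spray[OF x, symmetric] M2.dK_spray[OF w, symmetric]
      by (simp add: Inl matrix_vector_mult_def sum_UNIV_sum P S_def sum_distrib_left sum.distrib algebra_simps)
    also have "\<dots> = Y $ \<nu>"
      by (simp add: Inl Y_def sum_UNIV_sum X snd_z sum_distrib_left sum.distrib algebra_simps)
    finally show ?thesis .
  next
    case (Inr i)
    have "(fundamental_matrix G z *v S) $ \<nu> =
        d2 (d2 f) (KH z) * dy i H w * M2.DK w + d2 f (KH z) * M2.E i w
        + d1 (d2 f) (KH z) * dy i H w * M1.DK x"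
      unfolding M2.dK_spray[OF w, symmetric] M2.g_spray[OF w, symmetric] M1.dK_spray[OF x, symmetric]
      by (simp add: Inr matrix_vector_mult_def sum_UNIV_sum P S_def sum_distrib_left sum.distrib algebra_simps)
    also have "\<dots> = Y $ \<nu>"
      by (simp add: Inr Y_def sum_UNIV_sum X snd_z sum_distrib_left sum.distrib algebra_simps)
    finally show ?thesis .
  qed
  then have "fundamental_matrix G z *v S = Y" by (simp add: vec_eq_iff)
  moreover have "invertible (fundamental_matrix G z)"
    using inverse_fundamental_matrix_product[OF z] by metis
  ultimately have "inverse_fundamental_matrix G z *v Y = S"
    by (metis inverse_fundamental_matrix_def matrix_inv_left matrix_vector_mul_assoc matrix_vector_mul_lid)
  then have "spray_coeff G \<nu> z = 1/2 * S $ \<nu>" for \<nu>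
    by (auto simp: spray_coeff_def Y_def matrix_vector_mult_def)
  from this[of "Inl a"] this[of "Inr i"]
  show "spray_coeff G (Inl a) z = spray_coeff K a (coords_fst z)"
    and "spray_coeff G (Inr i) z = spray_coeff H i (coords_snd z)"
    by (simp_all add: S_def x_def w_def)
qed

lemma dy_lift_fst:
  assumes F: "\<And>z. z \<in> slit \<Longrightarrow> F z = h (coords_fst z)" and h: "smooth_on M1.slit h" and z: "z \<in> slit"
  shows "dy (Inl a) F z = dy a h (coords_fst z)" and "dy (Inr i) F z = 0"
  using dy_coords_fst[OF smooth_onD(1)[OF h slitD(1)[OF z]]] dy_cong[OF open_slit z F]
  by simp_all

lemma dy_lift_snd:
  assumes F: "\<And>z. z \<in> slit \<Longrightarrow> F z = h (coords_snd z)" and h: "smooth_on M2.slit h" and z: "z \<in> slit"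
  shows "dy (Inr i) F z = dy i h (coords_snd z)" and "dy (Inl a) F z = 0"
  using dy_coords_snd[OF smooth_onD(1)[OF h slitD(2)[OF z]]] dy_cong[OF open_slit z F]
  by simp_all

lemma dy_zero:
  assumes "\<And>z. z \<in> slit \<Longrightarrow> F z = 0" and z: "z \<in> slit"
  shows "dy \<nu> F z = 0"
  using dy_cong[OF open_slit z assms(1)] by (simp add: dy_def)

text \<open>
  By \<open>spray_coeff_product\<close> the spray coefficients in directions of the first factor do not depend on
  the second factor, so a derivative in a direction of the latter, taken at any of the three stages, is zero.
\<close>

lemma berwald_fst:
  assumes z: "z \<in> slit"
  shows "berwald_curvature G (Inl d) (Inl a) (Inl b) (Inl c) z = berwald_curvature K d a b c (coords_fst z)"
    and "\<mu> \<in> range Inr \<or> \<nu> \<in> range Inr \<or> \<eta> \<in> range Inr \<Longrightarrow> berwald_curvature G (Inl d) \<mu> \<nu> \<eta> z = 0"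
proof -
  note S = spray_coeff_product(1) M1.smooth_spray
  have 1: "dy (Inl c) (spray_coeff G (Inl d)) z = dy c (spray_coeff K d) (coords_fst z)"
    "dy (Inr k) (spray_coeff G (Inl d)) z = 0" if "z \<in> slit" for z c k
    using dy_lift_fst[OF S that] by simp_all
  have 2: "dy (Inl b) (dy (Inl c) (spray_coeff G (Inl d))) z = dy b (dy c (spray_coeff K d)) (coords_fst z)"
    "dy (Inr k) (dy (Inl c) (spray_coeff G (Inl d))) z = 0" if "z \<in> slit" for z b c k
    using dy_lift_fst[OF 1(1) smooth_on_dy[OF M1.smooth_spray] that] by simp_all
  have 3: "dy (Inl a) (dy (Inl b) (dy (Inl c) (spray_coeff G (Inl d)))) z =
      dy a (dy b (dy c (spray_coeff K d))) (coords_fst z)"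
    "dy (Inr k) (dy (Inl b) (dy (Inl c) (spray_coeff G (Inl d)))) z = 0" if "z \<in> slit" for z a b c k
    using dy_lift_fst[OF 2(1) smooth_on_dy[OF smooth_on_dy[OF M1.smooth_spray]] that] by simp_all
  show "berwald_curvature G (Inl d) (Inl a) (Inl b) (Inl c) z = berwald_curvature K d a b c (coords_fst z)"
    using 3(1)[OF z] by (simp add: berwald_curvature_def)
  show "berwald_curvature G (Inl d) \<mu> \<nu> \<eta> z = 0"
    if "\<mu> \<in> range Inr \<or> \<nu> \<in> range Inr \<or> \<eta> \<in> range Inr"
  proof (cases \<eta>)
    case (Inr k)
    have "dy \<nu> (dy \<eta> (spray_coeff G (Inl d))) z = 0" if "z \<in> slit" for z
      using dy_zero[OF _ that, of "dy \<eta> (spray_coeff G (Inl d))"] 1(2) by (simp add: Inr)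
    then show ?thesis
      unfolding berwald_curvature_def by (rule dy_zero[OF _ z])
  next
    case (Inl c)
    then show ?thesis
    proof (cases \<nu>)
      case (Inr k)
      have "dy \<mu> (dy (Inr k) (dy (Inl c) (spray_coeff G (Inl d)))) z = 0"
        by (rule dy_zero[OF _ z]) (rule 2(2))
      then show ?thesis
        by (simp add: berwald_curvature_def \<open>\<eta> = Inl c\<close> Inr)
    next
      case (Inl b)
      then show ?thesis
        unfolding berwald_curvature_def using \<open>\<eta> = Inl c\<close> 3(2)[OF z] that by auto
    qed
  qed
qed

lemma berwald_snd:
  assumes z: "z \<in> slit"
  shows "berwald_curvature G (Inr l) (Inr i) (Inr j) (Inr k) z = berwald_curvature H l i j k (coords_snd z)"
    and "\<mu> \<in> range Inl \<or> \<nu> \<in> range Inl \<or> \<eta> \<in> range Inl \<Longrightarrow> berwald_curvature G (Inr l) \<mu> \<nu> \<eta> z = 0"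
proof -
  note S = spray_coeff_product(2) M2.smooth_spray
  have 1: "dy (Inr k) (spray_coeff G (Inr l)) z = dy k (spray_coeff H l) (coords_snd z)"
    "dy (Inl c) (spray_coeff G (Inr l)) z = 0" if "z \<in> slit" for z c k
    using dy_lift_snd[OF S that] by simp_all
  have 2: "dy (Inr j) (dy (Inr k) (spray_coeff G (Inr l))) z = dy j (dy k (spray_coeff H l)) (coords_snd z)"
    "dy (Inl c) (dy (Inr k) (spray_coeff G (Inr l))) z = 0" if "z \<in> slit" for z j c k
    using dy_lift_snd[OF 1(1) smooth_on_dy[OF M2.smooth_spray] that] by simp_all
  have 3: "dy (Inr i) (dy (Inr j) (dy (Inr k) (spray_coeff G (Inr l)))) z =
      dy i (dy j (dy k (spray_coeff H l))) (coords_snd z)"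
    "dy (Inl c) (dy (Inr j) (dy (Inr k) (spray_coeff G (Inr l)))) z = 0" if "z \<in> slit" for z i j c k
    using dy_lift_snd[OF 2(1) smooth_on_dy[OF smooth_on_dy[OF M2.smooth_spray]] that] by simp_all
  show "berwald_curvature G (Inr l) (Inr i) (Inr j) (Inr k) z = berwald_curvature H l i j k (coords_snd z)"
    using 3(1)[OF z] by (simp add: berwald_curvature_def)
  show "berwald_curvature G (Inr l) \<mu> \<nu> \<eta> z = 0"
    if "\<mu> \<in> range Inl \<or> \<nu> \<in> range Inl \<or> \<eta> \<in> range Inl"
  proof (cases \<eta>)
    case (Inl c)
    have "dy \<nu> (dy \<eta> (spray_coeff G (Inr l))) z = 0" if "z \<in> slit" for z
      using dy_zero[OF _ that, of "dy \<eta> (spray_coeff G (Inr l))"] 1(2) by (simp add: Inl)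
    then show ?thesis
      unfolding berwald_curvature_def by (rule dy_zero[OF _ z])
  next
    case (Inr k)
    then show ?thesis
    proof (cases \<nu>)
      case (Inl c)
      have "dy \<mu> (dy (Inl c) (dy (Inr k) (spray_coeff G (Inr l)))) z = 0"
        by (rule dy_zero[OF _ z]) (rule 2(2))
      then show ?thesis
        by (simp add: berwald_curvature_def \<open>\<eta> = Inr k\<close> Inl)
    next
      case (Inr j)
      then show ?thesis
        unfolding berwald_curvature_def using \<open>\<eta> = Inr k\<close> 3(2)[OF z] that by auto
    qed
  qed
qed

text \<open>
  This is Euler's relation for \<open>G\<close>, which has degree 2, in the form \<open>y_g\<close>. The rank one terms cancel by
  Euler's relation for the partial derivatives of \<open>f\<close>.
\<close>

lemma y_fundamental_matrix_product:
  assumes z: "z \<in> slit"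
  shows "(\<Sum>\<nu>\<in>UNIV. snd z $ \<nu> * fundamental_matrix G z $ \<nu> $ Inl a) = d1 f (KH z) * dy a K (coords_fst z)"
    and "(\<Sum>\<nu>\<in>UNIV. snd z $ \<nu> * fundamental_matrix G z $ \<nu> $ Inr i) = d2 f (KH z) * dy i H (coords_snd z)"
proof -
  define x where "x = coords_fst z"
  define w where "w = coords_snd z"
  have x: "x \<in> M1.slit" and w: "w \<in> M2.slit" using slitD[OF z] by (simp_all add: x_def w_def)
  have KH: "KH z = (K x, H w)" by (simp add: KH_def x_def w_def)
  have pos: "0 < K x" "0 < H w" using KH_quadrant[OF z] by (simp_all add: KH)
  note second = product_function_second_euler[OF f pos, folded KH]
    product_function_mixed_partials[OF f pos, folded KH]
  note P = fundamental_matrix_product[OF z, folded x_def w_def]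
  have snd_z: "snd z $ Inl b = snd x $ b" "snd z $ Inr j = snd w $ j" for b j
    by (simp_all add: x_def w_def)
  have "(\<Sum>\<nu>\<in>UNIV. snd z $ \<nu> * fundamental_matrix G z $ \<nu> $ Inl a) =
      d1 (d1 f) (KH z) * dy a K x * (\<Sum>b\<in>UNIV. snd x $ b * dy b K x)
      + d1 f (KH z) * (\<Sum>b\<in>UNIV. snd x $ b * M1.g x $ b $ a)
      + d1 (d2 f) (KH z) * dy a K x * (\<Sum>j\<in>UNIV. snd w $ j * dy j H w)"
    by (simp add: sum_UNIV_sum P snd_z sum_distrib_left sum.distrib algebra_simps)
  also have "\<dots> = d1 f (KH z) * dy a K x
      + 2 * dy a K x * (K x * d1 (d1 f) (KH z) + H w * d1 (d2 f) (KH z))"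
    unfolding M1.euler_K[OF x] M1.y_g[OF x] M2.euler_K[OF w] by (simp add: algebra_simps)
  also have "K x * d1 (d1 f) (KH z) + H w * d1 (d2 f) (KH z) = 0"
    using second by simp
  finally show "(\<Sum>\<nu>\<in>UNIV. snd z $ \<nu> * fundamental_matrix G z $ \<nu> $ Inl a) = d1 f (KH z) * dy a K (coords_fst z)"
    by (simp add: x_def)
  have "(\<Sum>\<nu>\<in>UNIV. snd z $ \<nu> * fundamental_matrix G z $ \<nu> $ Inr i) =
      d2 (d2 f) (KH z) * dy i H w * (\<Sum>j\<in>UNIV. snd w $ j * dy j H w)
      + d2 f (KH z) * (\<Sum>j\<in>UNIV. snd w $ j * M2.g w $ j $ i)
      + d1 (d2 f) (KH z) * dy i H w * (\<Sum>b\<in>UNIV. snd x $ b * dy b K x)"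
    by (simp add: sum_UNIV_sum P snd_z sum_distrib_left sum.distrib algebra_simps)
  also have "\<dots> = d2 f (KH z) * dy i H w
      + 2 * dy i H w * (K x * d1 (d2 f) (KH z) + H w * d2 (d2 f) (KH z))"
    unfolding M1.euler_K[OF x] M2.y_g[OF w] M2.euler_K[OF w] by (simp add: algebra_simps)
  also have "K x * d1 (d2 f) (KH z) + H w * d2 (d2 f) (KH z) = 0"
    using second by simp
  finally show "(\<Sum>\<nu>\<in>UNIV. snd z $ \<nu> * fundamental_matrix G z $ \<nu> $ Inr i) = d2 f (KH z) * dy i H (coords_snd z)"
    by (simp add: w_def)
qed

lemma landsberg_product_expand:
  assumes z: "z \<in> slit"
  shows "landsberg_curvature G \<beta> \<gamma> \<eta> z = - (1/4) *
    ((\<Sum>d\<in>UNIV. d1 f (KH z) * dy d K (coords_fst z) * berwald_curvature G (Inl d) \<beta> \<gamma> \<eta> z) +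
     (\<Sum>l\<in>UNIV. d2 f (KH z) * dy l H (coords_snd z) * berwald_curvature G (Inr l) \<beta> \<gamma> \<eta> z))"
proof -
  have "(\<Sum>\<nu>\<in>UNIV. \<Sum>\<alpha>\<in>UNIV. snd z $ \<nu> * fundamental_matrix G z $ \<nu> $ \<alpha> * berwald_curvature G \<alpha> \<beta> \<gamma> \<eta> z)
    = (\<Sum>\<alpha>\<in>UNIV. (\<Sum>\<nu>\<in>UNIV. snd z $ \<nu> * fundamental_matrix G z $ \<nu> $ \<alpha>) * berwald_curvature G \<alpha> \<beta> \<gamma> \<eta> z)"
    by (subst sum.swap) (simp add: sum_distrib_right)
  also have "\<dots> = (\<Sum>d\<in>UNIV. d1 f (KH z) * dy d K (coords_fst z) * berwald_curvature G (Inl d) \<beta> \<gamma> \<eta> z) +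
     (\<Sum>l\<in>UNIV. d2 f (KH z) * dy l H (coords_snd z) * berwald_curvature G (Inr l) \<beta> \<gamma> \<eta> z)"
    by (subst sum_UNIV_sum) (simp only: y_fundamental_matrix_product[OF z])
  finally show ?thesis by (simp only: landsberg_curvature_def)
qed

lemma landsberg_product:
  assumes z: "z \<in> slit"
  shows "landsberg_curvature G (Inl a) (Inl b) (Inl c) z =
      d1 f (KH z) * landsberg_curvature K a b c (coords_fst z)"
    and "landsberg_curvature G (Inr i) (Inr j) (Inr k) z =
      d2 f (KH z) * landsberg_curvature H i j k (coords_snd z)"
    and "landsberg_curvature G (Inl a) (Inl b) (Inr k) z = 0"
    and "landsberg_curvature G (Inl a) (Inr j) \<eta> z = 0"
    and "landsberg_curvature G (Inr i) (Inr j) (Inl c) z = 0"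
    and "landsberg_curvature G (Inr i) (Inl b) \<eta> z = 0"
  by (simp_all add: landsberg_product_expand[OF z] berwald_fst[OF z] berwald_snd[OF z]
      M1.landsberg_eq[OF slitD(1)[OF z]] M2.landsberg_eq[OF slitD(2)[OF z]]
      sum_distrib_left mult.assoc)

theorem mean_landsberg_product:
  assumes z: "z \<in> slit"
  shows "mean_landsberg_curvature G (Inl a) z = mean_landsberg_curvature K a (coords_fst z)"
    and "mean_landsberg_curvature G (Inr i) z = mean_landsberg_curvature H i (coords_snd z)"
proof -
  obtain \<alpha> \<gamma> where R: "\<And>a b. inverse_fundamental_matrix G z $ Inl a $ Inl b =
      M1.ginv (coords_fst z) $ a $ b / d1 f (KH z) + \<alpha> * (snd z $ Inl a * snd z $ Inl b)"
    "\<And>i j. inverse_fundamental_matrix G z $ Inr i $ Inr j =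
      M2.ginv (coords_snd z) $ i $ j / d2 f (KH z) + \<gamma> * (snd z $ Inr i * snd z $ Inr j)"
    using inverse_fundamental_matrix_product[OF z] by metis
  have "d1 f (KH z) \<noteq> 0" "d2 f (KH z) \<noteq> 0"
    using f KH_quadrant[OF z] by (cases "KH z"; auto simp: product_function_def)+
  then show "mean_landsberg_curvature G (Inl a) z = mean_landsberg_curvature K a (coords_fst z)"
    and "mean_landsberg_curvature G (Inr i) z = mean_landsberg_curvature H i (coords_snd z)"
    using M1.trace_landsberg[OF slitD(1)[OF z], of "d1 f (KH z)" \<alpha> a]
      M2.trace_landsberg[OF slitD(2)[OF z], of "d2 f (KH z)" \<gamma> i]
    by (simp_all add: mean_landsberg_curvature_def[of G] sum_UNIV_sum landsberg_product[OF z] R)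
qed

end

section \<open>Tangent bundles in charts\<close>

text \<open>
  The properties of a smooth atlas on which the tangent bundle depends. The product of two atlases
  inherits them by the chain rule for first derivatives.
\<close>

definition differentiable_atlas :: "('p, 'n::finite) chart set \<Rightarrow> bool"
  where "differentiable_atlas A \<longleftrightarrow>
    (\<forall>c\<in>A. inj_on (snd c) (fst c)) \<and>
    (\<forall>c\<in>A. \<forall>d\<in>A. open (snd c ` (fst c \<inter> fst d)) \<and>
      (\<forall>p\<in>fst c \<inter> fst d. (snd d \<circ> chart_inv c) differentiable (at (snd c p))))"

lemma smooth_imp_differentiable_atlas:
  assumes "smooth_atlas X A"
  shows "differentiable_atlas A"
  unfolding differentiable_atlas_def
proof (intro conjI ballI)
  fix c assume c: "c \<in> A"
  have cX: "openin X (fst c)" "open (chart_image c)"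
    and hom: "homeomorphic_map (subtopology X (fst c)) (top_of_set (chart_image c)) (snd c)"
    using assms c by (auto simp: smooth_atlas_def)
  have top: "topspace (subtopology X (fst c)) = fst c"
    using openin_subset[OF cX(1)] by auto
  show "inj_on (snd c) (fst c)"
    using homeomorphic_imp_injective_map[OF hom] unfolding top .
  fix d assume d: "d \<in> A"
  have "openin X (fst d)" using assms d by (auto simp: smooth_atlas_def)
  then have "openin (subtopology X (fst c)) (fst c \<inter> fst d)"
    by (auto simp: openin_subtopology)
  then have "openin (top_of_set (chart_image c)) (snd c ` (fst c \<inter> fst d))"
    using homeomorphic_imp_open_map[OF hom] by (simp add: open_map_def)
  then show "open (snd c ` (fst c \<inter> fst d))"
    using cX(2) openin_open_eq by blast
  fix p assume "p \<in> fst c \<inter> fst d"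
  moreover have "smooth_on (snd c ` (fst c \<inter> fst d)) (snd d \<circ> chart_inv c)"
    using assms c d by (auto simp: smooth_atlas_def)
  ultimately show "(snd d \<circ> chart_inv c) differentiable (at (snd c p))"
    by (intro smooth_onD(1)) auto
qed

lemma chart_inv_chart:
  "differentiable_atlas A \<Longrightarrow> c \<in> A \<Longrightarrow> p \<in> fst c \<Longrightarrow> chart_inv c (snd c p) = p"
  by (simp add: differentiable_atlas_def chart_inv_def)

lemma open_chart_image:
  assumes "differentiable_atlas A" "c \<in> A"
  shows "open (chart_image c)"
proof -
  have "open (snd c ` (fst c \<inter> fst c))" using assms unfolding differentiable_atlas_def by blast
  then show ?thesis by (simp add: chart_image_def)
qed

abbreviation transition_derivative ::
    "('p, 'n::finite) chart \<Rightarrow> ('p, 'n) chart \<Rightarrow> 'p \<Rightarrow> real ^ 'n \<Rightarrow> real ^ 'n"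
  where "transition_derivative c d p \<equiv> frechet_derivative (snd d \<circ> chart_inv c) (at (snd c p))"

lemma transition_differentiable:
  assumes "differentiable_atlas A" "c \<in> A" "d \<in> A" "p \<in> fst c" "p \<in> fst d"
  shows "(snd d \<circ> chart_inv c) differentiable (at (snd c p))"
  using assms by (simp add: differentiable_atlas_def)

lemma open_chart_overlap:
  assumes "differentiable_atlas A" "c \<in> A" "d \<in> A"
  shows "open (snd c ` (fst c \<inter> fst d))"
  using assms by (simp add: differentiable_atlas_def)

lemma transition_derivative_self:
  assumes A: "differentiable_atlas A" and c: "c \<in> A" "p \<in> fst c"
  shows "transition_derivative c c p w = w"
proof -
  have "transition_derivative c c p = frechet_derivative (\<lambda>x. x) (at (snd c p))"
    by (rule frechet_derivative_cong_open[OF open_chart_image[OF A c(1)]])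
      (use c in \<open>auto simp: chart_image_def chart_inv_chart[OF A]\<close>)
  then show ?thesis by simp
qed

text \<open>
  The chain rule, in the form which ensures that the coordinate vector in a single chart extends to a tangent vector.
\<close>

lemma transition_derivative_cocycle:
  assumes A: "differentiable_atlas A" and c: "c \<in> A" "p \<in> fst c" and d: "d \<in> A" "p \<in> fst d"
    and e: "e \<in> A" "p \<in> fst e"
  shows "transition_derivative d e p (transition_derivative c d p w) = transition_derivative c e p w"
proof -
  let ?f = "snd d \<circ> chart_inv c" and ?g = "snd e \<circ> chart_inv d"
  have fp: "?f (snd c p) = snd d p" by (simp add: chart_inv_chart[OF A c])
  have "frechet_derivative (?g \<circ> ?f) (at (snd c p)) =
      frechet_derivative ?g (at (?f (snd c p))) \<circ> frechet_derivative ?f (at (snd c p))"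
    by (rule frechet_derivative_compose)
      (use transition_differentiable[OF A] c d e fp in auto)
  moreover have "frechet_derivative (?g \<circ> ?f) (at (snd c p)) = transition_derivative c e p"
    by (rule frechet_derivative_cong_open[OF open_chart_overlap[OF A c(1) d(1)]])
      (use c d in \<open>auto simp: chart_inv_chart[OF A]\<close>)
  ultimately have "frechet_derivative ?g (at (?f (snd c p))) \<circ> frechet_derivative ?f (at (snd c p)) =
      transition_derivative c e p"
    by (rule trans[OF sym])
  from fun_cong[OF this, of w] show ?thesis
    unfolding fp by (simp only: comp_apply)
qed

lemma tangent_bundle_iff:
  "v \<in> tangent_bundle A \<longleftrightarrow> fst v \<in> (\<Union>c\<in>A. fst c) \<and>
    (\<forall>c\<in>A. \<forall>d\<in>A. fst v \<in> fst c \<inter> fst d \<longrightarrow> snd v d = transition_derivative c d (fst v) (snd v c)) \<and>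
    (\<forall>c. \<not> (c \<in> A \<and> fst v \<in> fst c) \<longrightarrow> snd v c = 0)"
  by (simp only: tangent_bundle_def case_prod_beta mem_Collect_eq)

lemma tangent_bundle_transition:
  assumes "v \<in> tangent_bundle A" "c \<in> A" "d \<in> A" "fst v \<in> fst c" "fst v \<in> fst d"
  shows "snd v d = transition_derivative c d (fst v) (snd v c)"
  using assms unfolding tangent_bundle_iff by blast

lemma tangent_bundle_outside:
  assumes "v \<in> tangent_bundle A" "\<not> (d \<in> A \<and> fst v \<in> fst d)"
  shows "snd v d = 0"
  using assms unfolding tangent_bundle_iff by blast

lemma tangent_vector_with_coordinates:
  assumes A: "differentiable_atlas A" and c: "c \<in> A" "p \<in> fst c"
  obtains v where "v \<in> tangent_bundle A" "fst v = p" "snd v c = w"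
proof
  let ?\<xi> = "\<lambda>d. if d \<in> A \<and> p \<in> fst d then transition_derivative c d p w else 0"
  show "(p, ?\<xi>) \<in> tangent_bundle A"
    unfolding tangent_bundle_iff using c transition_derivative_cocycle[OF A c] by auto
  show "snd (p, ?\<xi>) c = w"
    using c transition_derivative_self[OF A c] by simp
qed simp

lemma tangent_bundle_eqI:
  assumes v: "v \<in> tangent_bundle A" and w: "w \<in> tangent_bundle A"
    and c: "c \<in> A" "fst v \<in> fst c" and eq: "fst v = fst w" "snd v c = snd w c"
  shows "v = w"
proof (rule prod_eqI[OF eq(1)], rule ext)
  fix d
  show "snd v d = snd w d"
  proof (cases "d \<in> A \<and> fst v \<in> fst d")
    case True
    then show ?thesis
      using tangent_bundle_transition[OF v c(1), of d] tangent_bundle_transition[OF w c(1), of d] c eq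
      by simp
  next
    case False
    then show ?thesis using tangent_bundle_outside[OF v] tangent_bundle_outside[OF w] eq(1) by simp
  qed
qed

lemma tchart_inv_tchart:
  assumes A: "differentiable_atlas A" and c: "c \<in> A" and v: "v \<in> tangent_bundle A" "fst v \<in> fst c"
  shows "tchart_inv A c (tchart c v) = v"
  unfolding tchart_inv_def
proof (rule inv_into_f_f)
  show "inj_on (tchart c) {v \<in> tangent_bundle A. fst v \<in> fst c}"
  proof (rule inj_onI)
    fix v w assume *: "v \<in> {v \<in> tangent_bundle A. fst v \<in> fst c}"
      "w \<in> {v \<in> tangent_bundle A. fst v \<in> fst c}" "tchart c v = tchart c w"
    then have "fst v = fst w"
      using chart_inv_chart[OF A c] by (metis (no_types, lifting) mem_Collect_eq prod.inject tchart_def)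
    with * show "v = w"
      using c by (intro tangent_bundle_eqI[of v A w c]) (auto simp: tchart_def)
  qed
qed (use v in simp)

lemma tchart_surj:
  assumes A: "differentiable_atlas A" and c: "c \<in> A" and x: "x \<in> chart_image c"
  obtains v where "v \<in> tangent_bundle A" "fst v \<in> fst c" "tchart c v = (x, y)"
    "tchart_inv A c (x, y) = v"
proof -
  obtain p where p: "p \<in> fst c" "x = snd c p" using x by (auto simp: chart_image_def)
  obtain v where v: "v \<in> tangent_bundle A" "fst v = p" "snd v c = y"
    using tangent_vector_with_coordinates[OF A c p(1)] .
  then show ?thesis
    using that[of v] tchart_inv_tchart[OF A c v(1)] p by (simp add: tchart_def)
qed

lemma is_zero_iff:
  assumes A: "differentiable_atlas A" and c: "c \<in> A" and v: "v \<in> tangent_bundle A" "fst v \<in> fst c"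
  shows "is_zero v \<longleftrightarrow> snd v c = 0"
proof
  assume 0: "snd v c = 0"
  have "snd v d = 0" for d
  proof (cases "d \<in> A \<and> fst v \<in> fst d")
    case True
    have "linear (transition_derivative c d (fst v))"
      by (rule linear_frechet_derivative[OF transition_differentiable[OF A c]]) (use True v in auto)
    from linear_0[OF this] show ?thesis
      using tangent_bundle_transition[OF v(1) c, of d] True v(2) 0 by simp
  next
    case False
    then show ?thesis using tangent_bundle_outside[OF v(1)] by blast
  qed
  then show "is_zero v" by (auto simp: is_zero_def)
qed (simp add: is_zero_def)

lemma fst_tscale: "fst (tscale r v) = fst v"
  by (simp add: tscale_def)

lemma tscale_tangent_bundle:
  assumes A: "differentiable_atlas A" and v: "v \<in> tangent_bundle A"
  shows "tscale r v \<in> tangent_bundle A"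
proof -
  have "r *\<^sub>R snd v d = transition_derivative c d (fst v) (r *\<^sub>R snd v c)"
    if "c \<in> A" "d \<in> A" "fst v \<in> fst c" "fst v \<in> fst d" for c d
    using linear_cmul[OF linear_frechet_derivative[OF transition_differentiable[OF A that]]]
      tangent_bundle_transition[OF v that] by simp
  moreover have "r *\<^sub>R snd v d = 0" if "\<not> (d \<in> A \<and> fst v \<in> fst d)" for d
    using tangent_bundle_outside[OF v that] by simp
  moreover have "fst v \<in> (\<Union>c\<in>A. fst c)"
    using v unfolding tangent_bundle_iff by blast
  ultimately show ?thesis
    unfolding tangent_bundle_iff by (simp only: tscale_def fst_conv snd_conv) blast
qed

lemma finsler_chart_local_rep:
  assumes A: "differentiable_atlas A" and F: "finsler_metric A F" and c: "c \<in> A"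
  shows "finsler_chart (chart_image c) (local_rep A c (\<lambda>v. (F v)\<^sup>2))"
proof
  let ?K = "local_rep A c (\<lambda>v. (F v)\<^sup>2)"
  show "open (chart_image c)" by (rule open_chart_image[OF A c])
  show "smooth_on (chart_image c \<times> (- {0})) ?K"
    using F c by (simp add: finsler_metric_def)
  show "y_homogeneous 2 (chart_image c) ?K"
    unfolding y_homogeneous_def
  proof (intro ballI allI impI)
    fix x y and r :: real assume x: "x \<in> chart_image c" and r: "0 < r"
    obtain v where v: "v \<in> tangent_bundle A" "fst v \<in> fst c" "tchart c v = (x, y)" "tchart_inv A c (x, y) = v"
      using tchart_surj[OF A c x] .
    have "tchart c (tscale r v) = (x, r *\<^sub>R y)" using v(3) by (simp add: tchart_def tscale_def)
    then have "tchart_inv A c (x, r *\<^sub>R y) = tscale r v"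
      using tchart_inv_tchart[OF A c tscale_tangent_bundle[OF A v(1), of r]] v(2) fst_tscale by metis
    moreover have "F (tscale r v) = r * F v" using F v(1) r by (simp add: finsler_metric_def)
    ultimately show "?K (x, r *\<^sub>R y) = r\<^sup>2 * ?K (x, y)"
      using v(4) by (simp add: local_rep_def power_mult_distrib)
  qed
  show "0 < ?K (x, y)" if x: "x \<in> chart_image c" and y: "y \<noteq> 0" for x y
  proof -
    obtain v where v: "v \<in> tangent_bundle A" "fst v \<in> fst c" "tchart c v = (x, y)" "tchart_inv A c (x, y) = v"
      using tchart_surj[OF A c x] .
    then have "v \<in> slit_tangent_bundle A"
      using is_zero_iff[OF A c v(1,2)] y by (simp add: slit_tangent_bundle_def tchart_def)
    then have "0 < F v" using F by (simp add: finsler_metric_def)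
    then show ?thesis using v(4) by (simp add: local_rep_def)
  qed
  show "invertible (fundamental_matrix ?K (x, y))" if "x \<in> chart_image c" "y \<noteq> 0" for x y
  proof -
    have "\<forall>w. w \<noteq> 0 \<longrightarrow> 0 < w \<bullet> (fundamental_matrix ?K (x, y) *v w)"
      using F c that by (simp add: finsler_metric_def)
    then have "\<forall>w. fundamental_matrix ?K (x, y) *v w = 0 \<longrightarrow> w = 0"
      by (metis inner_zero_right less_irrefl)
    then show ?thesis
      by (simp add: invertible_left_inverse matrix_left_invertible_ker)
  qed
qed

section \<open>The tangent bundle of a product\<close>

definition vec_append :: "(real ^ 'm::finite) \<times> (real ^ 'n::finite) \<Rightarrow> real ^ ('m + 'n)"
  where "vec_append z = (\<chi> i. case i of Inl a \<Rightarrow> fst z $ a | Inr b \<Rightarrow> snd z $ b)"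

lemma vec_append_simps [simp]:
  "vec_fst (vec_append z) = fst z" "vec_snd (vec_append z) = snd z"
  "vec_append (vec_fst v, vec_snd v) = v"
  by (auto simp: vec_fst_def vec_snd_def vec_append_def vec_eq_iff split: sum.split)

lemma bounded_linear_vec_fst: "bounded_linear vec_fst"
  unfolding vec_fst_def
  by (intro linear_conv_bounded_linear[THEN iffD1] linearI) (auto simp: vec_eq_iff)

lemma bounded_linear_vec_snd: "bounded_linear vec_snd"
  unfolding vec_snd_def
  by (intro linear_conv_bounded_linear[THEN iffD1] linearI) (auto simp: vec_eq_iff)

lemma bounded_linear_vec_append: "bounded_linear vec_append"
  unfolding vec_append_def
  by (intro linear_conv_bounded_linear[THEN iffD1] linearI) (auto simp: vec_eq_iff split: sum.split)

lemma fst_prod_chart: "fst (prod_chart c d) = fst c \<times> fst d"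
  by (simp add: prod_chart_def)

lemma snd_prod_chart: "snd (prod_chart c d) z = vec_append (snd c (fst z), snd d (snd z))"
  by (cases z) (auto simp: prod_chart_def vec_append_def vec_eq_iff split: sum.split)

lemma prod_chart_overlap_image:
  "snd (prod_chart c d) ` (S \<times> T) = {v. vec_fst v \<in> snd c ` S \<and> vec_snd v \<in> snd d ` T}"
proof (intro set_eqI iffI)
  fix v assume "v \<in> {v. vec_fst v \<in> snd c ` S \<and> vec_snd v \<in> snd d ` T}"
  then obtain p q where "p \<in> S" "q \<in> T" "vec_fst v = snd c p" "vec_snd v = snd d q" by auto
  moreover from this have "v = snd (prod_chart c d) (p, q)"
    using vec_append_simps(3)[of v] by (simp add: snd_prod_chart)
  ultimately show "v \<in> snd (prod_chart c d) ` (S \<times> T)" by blast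
qed (auto simp: snd_prod_chart)

lemma vec_append_eq_iff: "vec_append z = vec_append w \<longleftrightarrow> z = w"
  by (metis prod_eqI vec_append_simps(1,2))

lemma inj_on_prod_chart:
  assumes "inj_on (snd c) (fst c)" "inj_on (snd d) (fst d)"
  shows "inj_on (snd (prod_chart c d)) (fst (prod_chart c d))"
  using assms by (auto simp: inj_on_def fst_prod_chart snd_prod_chart vec_append_eq_iff)

lemma open_prod_chart_overlap:
  assumes "open S" "open T"
  shows "open {v. vec_fst v \<in> S \<and> vec_snd v \<in> T}"
proof -
  have "{v. vec_fst v \<in> S \<and> vec_snd v \<in> T} = vec_fst -` S \<inter> vec_snd -` T" by auto
  then show ?thesis
    using assms bounded_linear_vec_fst bounded_linear_vec_snd
    by (auto intro!: open_Int open_vimage linear_continuous_on)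
qed

lemma differentiable_prod_atlas:
  assumes A: "differentiable_atlas A" and B: "differentiable_atlas B"
  shows "differentiable_atlas (prod_atlas A B)"
  unfolding differentiable_atlas_def
proof (intro conjI ballI)
  fix e assume "e \<in> prod_atlas A B"
  then obtain c d where e: "e = prod_chart c d" and cd: "c \<in> A" "d \<in> B" by (auto simp: prod_atlas_def)
  have inj: "inj_on (snd c) (fst c)" "inj_on (snd d) (fst d)"
    using A B cd by (simp_all add: differentiable_atlas_def)
  show inj_e: "inj_on (snd e) (fst e)" unfolding e by (rule inj_on_prod_chart[OF inj])
  fix e' assume "e' \<in> prod_atlas A B"
  then obtain c' d' where e': "e' = prod_chart c' d'" and cd': "c' \<in> A" "d' \<in> B"
    by (auto simp: prod_atlas_def)
  let ?S = "snd c ` (fst c \<inter> fst c')" and ?T = "snd d ` (fst d \<inter> fst d')"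
  have image: "snd e ` (fst e \<inter> fst e') = {v. vec_fst v \<in> ?S \<and> vec_snd v \<in> ?T}"
    by (simp add: e e' fst_prod_chart Times_Int_Times prod_chart_overlap_image)
  show op: "open (snd e ` (fst e \<inter> fst e'))"
    unfolding image
    by (rule open_prod_chart_overlap[OF open_chart_overlap[OF A cd(1) cd'(1)] open_chart_overlap[OF B cd(2) cd'(2)]])
  fix p assume p: "p \<in> fst e \<inter> fst e'"
  let ?g = "\<lambda>v. vec_append ((snd c' \<circ> chart_inv c) (vec_fst v), (snd d' \<circ> chart_inv d) (vec_snd v))"
  have p': "fst p \<in> fst c" "fst p \<in> fst c'" "snd p \<in> fst d" "snd p \<in> fst d'"
    using p by (auto simp: e e' fst_prod_chart)
  have "(\<lambda>v. (snd c' \<circ> chart_inv c) (vec_fst v)) differentiable (at (snd e p))"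
    using differentiable_chain_at[OF bounded_linear_imp_differentiable[OF bounded_linear_vec_fst],
        of "snd c' \<circ> chart_inv c" "snd e p"] transition_differentiable[OF A cd(1) cd'(1) p'(1,2)]
    by (simp add: comp_def e snd_prod_chart)
  moreover have "(\<lambda>v. (snd d' \<circ> chart_inv d) (vec_snd v)) differentiable (at (snd e p))"
    using differentiable_chain_at[OF bounded_linear_imp_differentiable[OF bounded_linear_vec_snd],
        of "snd d' \<circ> chart_inv d" "snd e p"] transition_differentiable[OF B cd(2) cd'(2) p'(3,4)]
    by (simp add: comp_def e snd_prod_chart)
  ultimately have "(\<lambda>v. ((snd c' \<circ> chart_inv c) (vec_fst v), (snd d' \<circ> chart_inv d) (vec_snd v)))
      differentiable (at (snd e p))"
    unfolding differentiable_def by (elim exE) (rule exI, rule has_derivative_Pair)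
  from differentiable_chain_at[OF this bounded_linear_imp_differentiable[OF bounded_linear_vec_append]]
  have "?g differentiable (at (snd e p))" by (simp add: comp_def)
  moreover have "?g v = (snd e' \<circ> chart_inv e) v" if v: "v \<in> snd e ` (fst e \<inter> fst e')" for v
  proof -
    obtain q where q: "q \<in> fst e" "q \<in> fst e'" "v = snd e q" using v by blast
    then have "chart_inv e v = q" using inj_e by (simp add: chart_inv_def)
    moreover have "chart_inv c (snd c (fst q)) = fst q" "chart_inv d (snd d (snd q)) = snd q"
      using q chart_inv_chart[OF A cd(1)] chart_inv_chart[OF B cd(2)] by (auto simp: e fst_prod_chart)
    ultimately show ?thesis using q(3) by (simp add: e e' snd_prod_chart)
  qed
  ultimately show "(snd e' \<circ> chart_inv e) differentiable (at (snd e p))"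
    using differentiable_cong_open[OF op, of "snd e p" ?g] p by auto
qed

lemma prod_chart_in_prod_atlas: "c \<in> A \<Longrightarrow> d \<in> B \<Longrightarrow> prod_chart c d \<in> prod_atlas A B"
  unfolding prod_atlas_def by blast

text \<open>
  The definition of the tangent map involves an arbitrary chart at the source. If \<open>h\<close> is the linear
  map \<open>L\<close> in the charts \<open>e\<close> and \<open>c\<close>, then passing from the arbitrary chart to \<open>e\<close> shows that the tangent map is
  \<open>L\<close> on coordinate vectors. The projections of a product are of this kind in product charts.
\<close>

lemma tangent_map_coordinates:
  fixes P :: "('p, 'k::finite) chart set" and A :: "('q, 'm::finite) chart set"
  assumes P: "differentiable_atlas P" and L: "bounded_linear L"
    and v: "v \<in> tangent_bundle P" and e: "e \<in> P" "fst v \<in> fst e"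
    and c: "c \<in> A" "h (fst v) \<in> fst c"
    and h: "\<And>p. p \<in> fst e \<Longrightarrow> snd c (h p) = L (snd e p)"
  shows "snd (tangent_map P A h v) c = L (snd v e)"
proof -
  define e1 where "e1 = (SOME e. e \<in> P \<and> fst v \<in> fst e)"
  have e1: "e1 \<in> P" "fst v \<in> fst e1"
    using someI[of "\<lambda>e. e \<in> P \<and> fst v \<in> fst e" e] e by (auto simp: e1_def)
  have "snd (tangent_map P A h v) c =
      frechet_derivative (snd c \<circ> h \<circ> chart_inv e1) (at (snd e1 (fst v))) (snd v e1)"
    using c by (simp add: tangent_map_def Let_def e1_def)
  also have "frechet_derivative (snd c \<circ> h \<circ> chart_inv e1) (at (snd e1 (fst v))) =
      frechet_derivative (\<lambda>x. L ((snd e \<circ> chart_inv e1) x)) (at (snd e1 (fst v)))"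
    by (rule frechet_derivative_cong_open[OF open_chart_overlap[OF P e1(1) e(1)]])
      (use e e1 h in \<open>auto simp: chart_inv_chart[OF P]\<close>)
  also have "\<dots> (snd v e1) = L (transition_derivative e1 e (fst v) (snd v e1))"
    by (rule frechet_derivative_linear_compose[OF L])
      (rule transition_differentiable[OF P e1(1) e(1) e1(2) e(2)])
  also have "transition_derivative e1 e (fst v) (snd v e1) = snd v e"
    by (rule tangent_bundle_transition[OF v e1(1) e(1) e1(2) e(2), symmetric])
  finally show ?thesis .
qed

lemma fst_tangent_map: "fst (tangent_map P A h v) = h (fst v)"
  by (simp add: tangent_map_def Let_def)

text \<open>
  The image of a tangent vector transforms correctly between any two charts \<open>c\<close> and \<open>c'\<close> at the target
  provided that for each of them there is a chart at the source with respect to which \<open>h\<close> is the linear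
  map \<open>L\<close>; then \<open>L\<close> carries the transition between the source charts to that between \<open>c\<close> and \<open>c'\<close>.
\<close>

lemma tangent_map_tangent_bundle:
  fixes P :: "('p, 'k::finite) chart set" and A :: "('q, 'm::finite) chart set"
  assumes P: "differentiable_atlas P" and A: "differentiable_atlas A" and L: "bounded_linear L"
    and v: "v \<in> tangent_bundle P"
    and cover: "h (fst v) \<in> (\<Union>c\<in>A. fst c)"
    and adapted: "\<And>c c'. c \<in> A \<Longrightarrow> c' \<in> A \<Longrightarrow> h (fst v) \<in> fst c \<Longrightarrow> h (fst v) \<in> fst c' \<Longrightarrow>
      \<exists>e\<in>P. \<exists>e'\<in>P. fst v \<in> fst e \<and> fst v \<in> fst e' \<and>
        (\<forall>p\<in>fst e. h p \<in> fst c \<and> snd c (h p) = L (snd e p)) \<and>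
        (\<forall>p\<in>fst e'. h p \<in> fst c' \<and> snd c' (h p) = L (snd e' p))"
  shows "tangent_map P A h v \<in> tangent_bundle A"
proof -
  let ?w = "tangent_map P A h v"
  have "snd ?w c' = transition_derivative c c' (h (fst v)) (snd ?w c)"
    if c: "c \<in> A" "h (fst v) \<in> fst c" and c': "c' \<in> A" "h (fst v) \<in> fst c'" for c c'
  proof -
    obtain e e' where e: "e \<in> P" "fst v \<in> fst e" and e': "e' \<in> P" "fst v \<in> fst e'"
      and h: "\<And>p. p \<in> fst e \<Longrightarrow> h p \<in> fst c \<and> snd c (h p) = L (snd e p)"
        "\<And>p. p \<in> fst e' \<Longrightarrow> h p \<in> fst c' \<and> snd c' (h p) = L (snd e' p)"
      using adapted[OF c(1) c'(1) c(2) c'(2)] by blast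
    have "snd ?w c' = L (snd v e')"
      by (rule tangent_map_coordinates[OF P L v e']) (use c' h in auto)
    also have "\<dots> = L (transition_derivative e e' (fst v) (snd v e))"
      using tangent_bundle_transition[OF v e(1) e'(1) e(2) e'(2)] by simp
    also have "\<dots> = frechet_derivative (\<lambda>x. L ((snd e' \<circ> chart_inv e) x)) (at (snd e (fst v))) (snd v e)"
      by (rule frechet_derivative_linear_compose[OF L, symmetric])
        (rule transition_differentiable[OF P e(1) e'(1) e(2) e'(2)])
    also have "frechet_derivative (\<lambda>x. L ((snd e' \<circ> chart_inv e) x)) (at (snd e (fst v))) =
        frechet_derivative (\<lambda>x. (snd c' \<circ> chart_inv c) (L x)) (at (snd e (fst v)))"
    proof (rule frechet_derivative_cong_open[OF open_chart_overlap[OF P e(1) e'(1)]])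
      fix x assume "x \<in> snd e ` (fst e \<inter> fst e')"
      then obtain p where p: "p \<in> fst e" "p \<in> fst e'" "x = snd e p" by auto
      have "L (snd e p) = snd c (h p)" using h(1)[OF p(1)] by simp
      moreover have "chart_inv c (snd c (h p)) = h p"
        by (rule chart_inv_chart[OF A c(1)]) (use h(1)[OF p(1)] in simp)
      ultimately show "L ((snd e' \<circ> chart_inv e) x) = (snd c' \<circ> chart_inv c) (L x)"
        using h(2)[OF p(2)] p chart_inv_chart[OF P e(1) p(1)] by simp
    qed (use e e' in auto)
    also have "\<dots> (snd v e) = frechet_derivative (snd c' \<circ> chart_inv c) (at (L (snd e (fst v)))) (L (snd v e))"
      by (rule frechet_derivative_compose_linear[OF L])
        (use transition_differentiable[OF A c(1) c'(1) c(2) c'(2)] h(1)[OF e(2)] in \<open>simp add: comp_def\<close>)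
    also have "L (snd e (fst v)) = snd c (h (fst v))" using h(1)[OF e(2)] by simp
    also have "L (snd v e) = snd ?w c"
      by (rule tangent_map_coordinates[OF P L v e, symmetric]) (use c h in auto)
    finally show ?thesis .
  qed
  moreover have "snd ?w c = 0" if "\<not> (c \<in> A \<and> h (fst v) \<in> fst c)" for c
    by (simp only: tangent_map_def Let_def snd_conv that if_False)
  ultimately show ?thesis
    using cover unfolding tangent_bundle_iff fst_tangent_map by blast
qed

lemma tangent_fst_product:
  assumes A: "differentiable_atlas A" and B: "differentiable_atlas B"
    and v: "v \<in> tangent_bundle (prod_atlas A B)"
    and c: "c \<in> A" "d \<in> B" "fst v \<in> fst (prod_chart c d)"
  shows "tangent_fst A B v \<in> tangent_bundle A" "fst (tangent_fst A B v) \<in> fst c"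
    "tchart c (tangent_fst A B v) = coords_fst (tchart (prod_chart c d) v)"
proof -
  note AB = differentiable_prod_atlas[OF A B]
  have p: "fst (fst v) \<in> fst c" "snd (fst v) \<in> fst d" using c(3) by (auto simp: fst_prod_chart)
  have h: "fst p \<in> fst c' \<and> snd c' (fst p) = vec_fst (snd (prod_chart c' d) p)"
    if "p \<in> fst (prod_chart c' d)" for p c'
    using that by (auto simp: fst_prod_chart snd_prod_chart)
  show "tangent_fst A B v \<in> tangent_bundle A"
    unfolding tangent_fst_def
  proof (rule tangent_map_tangent_bundle[OF AB A bounded_linear_vec_fst v], goal_cases)
    case 1
    then show ?case using c p by blast
  next
    case (2 c1 c2)
    have "fst v \<in> fst (prod_chart c1 d)" "fst v \<in> fst (prod_chart c2 d)"
      using 2 p by (auto simp: fst_prod_chart mem_Times_iff)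
    then show ?case
      using prod_chart_in_prod_atlas[OF 2(1) c(2)] prod_chart_in_prod_atlas[OF 2(2) c(2)] h by blast
  qed
  show "fst (tangent_fst A B v) \<in> fst c" using p by (simp add: tangent_fst_def fst_tangent_map)
  have "snd (tangent_fst A B v) c = vec_fst (snd v (prod_chart c d))"
    unfolding tangent_fst_def
    by (rule tangent_map_coordinates[OF AB bounded_linear_vec_fst v prod_chart_in_prod_atlas[OF c(1,2)] c(3)])
      (use p h c in blast)+
  then show "tchart c (tangent_fst A B v) = coords_fst (tchart (prod_chart c d) v)"
    by (simp add: tchart_def coords_fst_def tangent_fst_def fst_tangent_map snd_prod_chart)
qed

lemma tangent_snd_product:
  assumes A: "differentiable_atlas A" and B: "differentiable_atlas B"
    and v: "v \<in> tangent_bundle (prod_atlas A B)"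
    and c: "c \<in> A" "d \<in> B" "fst v \<in> fst (prod_chart c d)"
  shows "tangent_snd A B v \<in> tangent_bundle B" "fst (tangent_snd A B v) \<in> fst d"
    "tchart d (tangent_snd A B v) = coords_snd (tchart (prod_chart c d) v)"
proof -
  note AB = differentiable_prod_atlas[OF A B]
  have p: "fst (fst v) \<in> fst c" "snd (fst v) \<in> fst d" using c(3) by (auto simp: fst_prod_chart)
  have h: "snd p \<in> fst d' \<and> snd d' (snd p) = vec_snd (snd (prod_chart c d') p)"
    if "p \<in> fst (prod_chart c d')" for p d'
    using that by (auto simp: fst_prod_chart snd_prod_chart)
  show "tangent_snd A B v \<in> tangent_bundle B"
    unfolding tangent_snd_def
  proof (rule tangent_map_tangent_bundle[OF AB B bounded_linear_vec_snd v], goal_cases)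
    case 1
    then show ?case using c p by blast
  next
    case (2 d1 d2)
    have "fst v \<in> fst (prod_chart c d1)" "fst v \<in> fst (prod_chart c d2)"
      using 2 p by (auto simp: fst_prod_chart mem_Times_iff)
    then show ?case
      using prod_chart_in_prod_atlas[OF c(1) 2(1)] prod_chart_in_prod_atlas[OF c(1) 2(2)] h by blast
  qed
  show "fst (tangent_snd A B v) \<in> fst d" using p by (simp add: tangent_snd_def fst_tangent_map)
  have "snd (tangent_snd A B v) d = vec_snd (snd v (prod_chart c d))"
    unfolding tangent_snd_def
    by (rule tangent_map_coordinates[OF AB bounded_linear_vec_snd v prod_chart_in_prod_atlas[OF c(1,2)] c(3)])
      (use p h c in blast)+
  then show "tchart d (tangent_snd A B v) = coords_snd (tchart (prod_chart c d) v)"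
    by (simp add: tchart_def coords_snd_def tangent_snd_def fst_tangent_map snd_prod_chart)
qed

lemma product_chart_local_rep:
  assumes A: "differentiable_atlas A" and B: "differentiable_atlas B"
    and F: "finsler_metric A F" and F': "finsler_metric B F'" and f: "product_function f"
    and c: "c \<in> A" "d \<in> B"
  shows "product_chart (chart_image c) (local_rep A c (\<lambda>v. (F v)\<^sup>2))
    (chart_image d) (local_rep B d (\<lambda>v. (F' v)\<^sup>2)) f
    (local_rep (prod_atlas A B) (prod_chart c d) (\<lambda>v. (minkowskian_product f A F B F' v)\<^sup>2))"
proof (intro product_chart.intro product_chart_axioms.intro finsler_chart_local_rep[OF A F c(1)]
    finsler_chart_local_rep[OF B F' c(2)] f)
  note AB = differentiable_prod_atlas[OF A B] prod_chart_in_prod_atlas[OF c]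
  fix z assume z: "coords_fst z \<in> chart_image c \<times> - {0}" "coords_snd z \<in> chart_image d \<times> - {0}"
  then have "fst z \<in> chart_image (prod_chart c d)"
    by (simp add: chart_image_def fst_prod_chart prod_chart_overlap_image coords_fst_def coords_snd_def)
  then obtain v where v: "v \<in> tangent_bundle (prod_atlas A B)" "fst v \<in> fst (prod_chart c d)"
      "tchart (prod_chart c d) v = z" "tchart_inv (prod_atlas A B) (prod_chart c d) z = v"
    using tchart_surj[OF AB, of "fst z" "snd z"] by (metis prod.collapse)
  note t1 = tangent_fst_product[OF A B v(1) c v(2)] and t2 = tangent_snd_product[OF A B v(1) c v(2)]
  have "tchart_inv A c (coords_fst z) = tangent_fst A B v"
    "tchart_inv B d (coords_snd z) = tangent_snd A B v"
    using tchart_inv_tchart[OF A c(1) t1(1,2)] tchart_inv_tchart[OF B c(2) t2(1,2)] t1(3) t2(3) v(3)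
    by simp_all
  moreover have "0 \<le> f ((F (tangent_fst A B v))\<^sup>2, (F' (tangent_snd A B v))\<^sup>2)"
    using f by (simp add: product_function_def)
  ultimately show "local_rep (prod_atlas A B) (prod_chart c d) (\<lambda>v. (minkowskian_product f A F B F' v)\<^sup>2) z =
      f (local_rep A c (\<lambda>v. (F v)\<^sup>2) (coords_fst z), local_rep B d (\<lambda>v. (F' v)\<^sup>2) (coords_snd z))"
    using v(4) by (simp add: local_rep_def minkowskian_product_def)
qed

lemma slit_tangent_bundle_iff:
  assumes A: "differentiable_atlas A" and c: "c \<in> A" and v: "v \<in> tangent_bundle A" "fst v \<in> fst c"
  shows "v \<in> slit_tangent_bundle A \<longleftrightarrow> tchart c v \<in> chart_image c \<times> - {0}"
  using is_zero_iff[OF A c v] v by (auto simp: slit_tangent_bundle_def tchart_def chart_image_def)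

lemma product_slit_bundle_iff:
  assumes A: "differentiable_atlas A" and B: "differentiable_atlas B"
    and v: "v \<in> tangent_bundle (prod_atlas A B)"
    and c: "c \<in> A" "d \<in> B" "fst v \<in> fst (prod_chart c d)"
  shows "v \<in> product_slit_bundle A B \<longleftrightarrow>
    coords_fst (tchart (prod_chart c d) v) \<in> chart_image c \<times> - {0} \<and>
    coords_snd (tchart (prod_chart c d) v) \<in> chart_image d \<times> - {0}"
proof -
  note t1 = tangent_fst_product[OF A B v c] and t2 = tangent_snd_product[OF A B v c]
  show ?thesis
    using slit_tangent_bundle_iff[OF A c(1) t1(1,2)] slit_tangent_bundle_iff[OF B c(2) t2(1,2)]
      t1(1,3) t2(1,3) v
    by (simp add: product_slit_bundle_def slit_tangent_bundle_def)
qed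

lemma weakly_landsberg_iff_coordinates:
  fixes A :: "('p, 'n::finite) chart set"
  assumes A: "differentiable_atlas A"
  shows "weakly_landsberg A F \<longleftrightarrow> (\<forall>c\<in>A. \<forall>z\<in>chart_image c \<times> - {0}. \<forall>\<alpha>.
    mean_landsberg_curvature (local_rep A c (\<lambda>v. (F v)\<^sup>2)) \<alpha> z = 0)"
proof (intro iffI ballI allI)
  fix c and z :: "'n coords" and \<alpha> assume WL: "weakly_landsberg A F" and c: "c \<in> A" and z: "z \<in> chart_image c \<times> - {0}"
  then obtain v where v: "v \<in> tangent_bundle A" "fst v \<in> fst c" "tchart c v = z"
    using tchart_surj[OF A c, of "fst z" "snd z"] by (metis mem_Times_iff prod.collapse)
  have "v \<in> slit_tangent_bundle A"
    using slit_tangent_bundle_iff[OF A c v(1,2)] v(3) z by simp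
  then show "mean_landsberg_curvature (local_rep A c (\<lambda>v. (F v)\<^sup>2)) \<alpha> z = 0"
    using WL c v(2,3) unfolding weakly_landsberg_def weakly_landsberg_on_def by blast
next
  assume *: "\<forall>c\<in>A. \<forall>z\<in>chart_image c \<times> - {0}. \<forall>\<alpha>.
    mean_landsberg_curvature (local_rep A c (\<lambda>v. (F v)\<^sup>2)) \<alpha> z = 0"
  show "weakly_landsberg A F"
    unfolding weakly_landsberg_def weakly_landsberg_on_def
  proof (intro ballI impI allI)
    fix v c \<alpha> assume v: "v \<in> slit_tangent_bundle A" and c: "c \<in> A" "fst v \<in> fst c"
    have "tchart c v \<in> chart_image c \<times> - {0}"
      using slit_tangent_bundle_iff[OF A c(1) _ c(2)] v by (simp add: slit_tangent_bundle_def)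
    then show "mean_landsberg_curvature (local_rep A c (\<lambda>v. (F v)\<^sup>2)) \<alpha> (tchart c v) = 0"
      by (rule *[rule_format, OF c(1)])
  qed
qed

lemma weakly_landsberg_product_iff_coordinates:
  assumes A: "differentiable_atlas A" and B: "differentiable_atlas B"
  shows "weakly_landsberg_product f A F B F' \<longleftrightarrow>
    (\<forall>c\<in>A. \<forall>d\<in>B. \<forall>z. coords_fst z \<in> chart_image c \<times> - {0} \<longrightarrow> coords_snd z \<in> chart_image d \<times> - {0} \<longrightarrow>
      (\<forall>\<alpha>. mean_landsberg_curvature (local_rep (prod_atlas A B) (prod_chart c d)
        (\<lambda>v. (minkowskian_product f A F B F' v)\<^sup>2)) \<alpha> z = 0))"
proof (intro iffI ballI allI impI)
  note AB = differentiable_prod_atlas[OF A B]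
  fix c d z \<alpha> assume WL: "weakly_landsberg_product f A F B F'" and c: "c \<in> A" "d \<in> B"
    and z: "coords_fst z \<in> chart_image c \<times> - {0}" "coords_snd z \<in> chart_image d \<times> - {0}"
  have "fst z \<in> chart_image (prod_chart c d)"
    using z by (simp add: chart_image_def fst_prod_chart prod_chart_overlap_image coords_fst_def coords_snd_def)
  then obtain v where v: "v \<in> tangent_bundle (prod_atlas A B)" "fst v \<in> fst (prod_chart c d)"
      "tchart (prod_chart c d) v = z"
    using tchart_surj[OF AB prod_chart_in_prod_atlas[OF c], of "fst z" "snd z"] by (metis prod.collapse)
  have "v \<in> product_slit_bundle A B"
    using product_slit_bundle_iff[OF A B v(1) c v(2)] z v(3) by simp
  then show "mean_landsberg_curvature (local_rep (prod_atlas A B) (prod_chart c d)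
      (\<lambda>v. (minkowskian_product f A F B F' v)\<^sup>2)) \<alpha> z = 0"
    using WL v(2,3) prod_chart_in_prod_atlas[OF c]
    by (auto simp: weakly_landsberg_product_def weakly_landsberg_on_def)
next
  assume *: "\<forall>c\<in>A. \<forall>d\<in>B. \<forall>z. coords_fst z \<in> chart_image c \<times> - {0} \<longrightarrow> coords_snd z \<in> chart_image d \<times> - {0} \<longrightarrow>
      (\<forall>\<alpha>. mean_landsberg_curvature (local_rep (prod_atlas A B) (prod_chart c d)
        (\<lambda>v. (minkowskian_product f A F B F' v)\<^sup>2)) \<alpha> z = 0)"
  show "weakly_landsberg_product f A F B F'"
    unfolding weakly_landsberg_product_def weakly_landsberg_on_def
  proof (intro ballI impI allI)
    fix v e \<alpha> assume v: "v \<in> product_slit_bundle A B" and e: "e \<in> prod_atlas A B" "fst v \<in> fst e"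
    obtain c d where cd: "e = prod_chart c d" "c \<in> A" "d \<in> B" using e(1) by (auto simp: prod_atlas_def)
    have "v \<in> tangent_bundle (prod_atlas A B)" using v by (simp add: product_slit_bundle_def)
    from product_slit_bundle_iff[OF A B this cd(2,3) e(2)[unfolded cd(1)]] v
    have "coords_fst (tchart (prod_chart c d) v) \<in> chart_image c \<times> - {0}"
      "coords_snd (tchart (prod_chart c d) v) \<in> chart_image d \<times> - {0}" by simp_all
    from *[rule_format, OF cd(2,3) this]
    show "mean_landsberg_curvature (local_rep (prod_atlas A B) e
        (\<lambda>v. (minkowskian_product f A F B F' v)\<^sup>2)) \<alpha> (tchart e v) = 0"
      unfolding cd(1) .
  qed
qed

section \<open>Weakly Landsberg products\<close>

theorem theorem4p11:
  fixes M\<^sub>1 :: "'p topology" and A\<^sub>1 :: "('p, 'm::finite) chart set"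
    and F\<^sub>1 :: "('p, 'm) tvec \<Rightarrow> real"
    and M\<^sub>2 :: "'q topology" and A\<^sub>2 :: "('q, 'n::finite) chart set"
    and F\<^sub>2 :: "('q, 'n) tvec \<Rightarrow> real"
    and f :: "real \<times> real \<Rightarrow> real"
  assumes "finsler_manifold M\<^sub>1 A\<^sub>1 F\<^sub>1"
    and "finsler_manifold M\<^sub>2 A\<^sub>2 F\<^sub>2"
    and "product_function f"
  shows "weakly_landsberg_product f A\<^sub>1 F\<^sub>1 A\<^sub>2 F\<^sub>2 \<longleftrightarrow>
    weakly_landsberg A\<^sub>1 F\<^sub>1 \<and> weakly_landsberg A\<^sub>2 F\<^sub>2"
proof -
  let ?K = "\<lambda>c. local_rep A\<^sub>1 c (\<lambda>v. (F\<^sub>1 v)\<^sup>2)" and ?H = "\<lambda>d. local_rep A\<^sub>2 d (\<lambda>v. (F\<^sub>2 v)\<^sup>2)"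
  let ?G = "\<lambda>c d. local_rep (prod_atlas A\<^sub>1 A\<^sub>2) (prod_chart c d)
    (\<lambda>v. (minkowskian_product f A\<^sub>1 F\<^sub>1 A\<^sub>2 F\<^sub>2 v)\<^sup>2)"
  have A1: "differentiable_atlas A\<^sub>1" and A2: "differentiable_atlas A\<^sub>2"
    using assms(1,2) smooth_imp_differentiable_atlas
    unfolding finsler_manifold_def smooth_manifold_def by blast+
  have F: "finsler_metric A\<^sub>1 F\<^sub>1" "finsler_metric A\<^sub>2 F\<^sub>2"
    using assms(1,2) by (simp_all add: finsler_manifold_def)
  have mean: "mean_landsberg_curvature (?G c d) (Inl a) z = mean_landsberg_curvature (?K c) a (coords_fst z)"
    "mean_landsberg_curvature (?G c d) (Inr i) z = mean_landsberg_curvature (?H d) i (coords_snd z)"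
    if "c \<in> A\<^sub>1" "d \<in> A\<^sub>2" "coords_fst z \<in> chart_image c \<times> - {0}" "coords_snd z \<in> chart_image d \<times> - {0}"
    for c d z a i
  proof -
    interpret product_chart "chart_image c" "?K c" "chart_image d" "?H d" f "?G c d"
      by (rule product_chart_local_rep[OF A1 A2 F assms(3) that(1,2)])
    have "z \<in> slit" using that by (simp add: slit_def)
    then show "mean_landsberg_curvature (?G c d) (Inl a) z = mean_landsberg_curvature (?K c) a (coords_fst z)"
      "mean_landsberg_curvature (?G c d) (Inr i) z = mean_landsberg_curvature (?H d) i (coords_snd z)"
      by (rule mean_landsberg_product)+
  qed
  have nonempty: "\<exists>c\<in>A. \<exists>z. z \<in> chart_image c \<times> - {0 :: real ^ 'k}"
    if "finsler_manifold M A F" for M and A :: "('r, 'k::finite) chart set" and F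
  proof -
    have "(\<Union>c\<in>A. fst c) \<noteq> {}"
      using that by (simp add: finsler_manifold_def smooth_manifold_def smooth_atlas_def)
    then obtain c p where "c \<in> A" "p \<in> fst c" by blast
    moreover have "(1 :: real ^ 'k) \<noteq> 0" by simp
    ultimately have "(snd c p, 1) \<in> chart_image c \<times> - {0 :: real ^ 'k}"
      by (simp add: chart_image_def)
    then show ?thesis using \<open>c \<in> A\<close> by (intro bexI[of _ c] exI[of _ "(snd c p, 1)"])
  qed
  have pair: "\<exists>z. coords_fst z = x \<and> coords_snd z = w" for x :: "'m coords" and w :: "'n coords"
    by (rule exI[of _ "(vec_append (fst x, fst w), vec_append (snd x, snd w))"])
      (simp add: coords_fst_def coords_snd_def)
  show ?thesis
    unfolding weakly_landsberg_product_iff_coordinates[OF A1 A2]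
      weakly_landsberg_iff_coordinates[OF A1] weakly_landsberg_iff_coordinates[OF A2]
  proof (intro iffI conjI ballI allI impI)
    assume *: "\<forall>c\<in>A\<^sub>1. \<forall>d\<in>A\<^sub>2. \<forall>z. coords_fst z \<in> chart_image c \<times> - {0} \<longrightarrow>
      coords_snd z \<in> chart_image d \<times> - {0} \<longrightarrow> (\<forall>\<alpha>. mean_landsberg_curvature (?G c d) \<alpha> z = 0)"
    show "mean_landsberg_curvature (?K c) a x = 0"
      if c: "c \<in> A\<^sub>1" "x \<in> chart_image c \<times> - {0}" for c x a
    proof -
      obtain d and w :: "'n coords" where d: "d \<in> A\<^sub>2" "w \<in> chart_image d \<times> - {0}"
        using nonempty[OF assms(2)] by blast
      obtain z where z: "coords_fst z = x" "coords_snd z = w" using pair by blast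
      then have slit: "coords_fst z \<in> chart_image c \<times> - {0}" "coords_snd z \<in> chart_image d \<times> - {0}"
        using c d by simp_all
      show ?thesis
        using *[rule_format, OF c(1) d(1) slit] mean(1)[OF c(1) d(1) slit] z(1) by simp
    qed
    show "mean_landsberg_curvature (?H d) i w = 0"
      if d: "d \<in> A\<^sub>2" "w \<in> chart_image d \<times> - {0}" for d w i
    proof -
      obtain c and x :: "'m coords" where c: "c \<in> A\<^sub>1" "x \<in> chart_image c \<times> - {0}"
        using nonempty[OF assms(1)] by blast
      obtain z where z: "coords_fst z = x" "coords_snd z = w" using pair by blast
      then have slit: "coords_fst z \<in> chart_image c \<times> - {0}" "coords_snd z \<in> chart_image d \<times> - {0}"
        using c d by simp_all
      show ?thesis
        using *[rule_format, OF c(1) d(1) slit] mean(2)[OF c(1) d(1) slit] z(2) by simp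
    qed
  next
    fix c d z \<alpha>
    assume K_H: "(\<forall>c\<in>A\<^sub>1. \<forall>z\<in>chart_image c \<times> - {0}. \<forall>\<alpha>. mean_landsberg_curvature (?K c) \<alpha> z = 0) \<and>
      (\<forall>d\<in>A\<^sub>2. \<forall>z\<in>chart_image d \<times> - {0}. \<forall>\<alpha>. mean_landsberg_curvature (?H d) \<alpha> z = 0)"
      and cd: "c \<in> A\<^sub>1" "d \<in> A\<^sub>2"
      and z: "coords_fst z \<in> chart_image c \<times> - {0}" "coords_snd z \<in> chart_image d \<times> - {0}"
    show "mean_landsberg_curvature (?G c d) \<alpha> z = 0"
      using mean[OF cd z] K_H[THEN conjunct1, rule_format, OF cd(1) z(1)]
        K_H[THEN conjunct2, rule_format, OF cd(2) z(2)]
      by (cases \<alpha>) simp_all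
  qed
qed

end
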